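(* The decision problem LC\&RP is reducible to the decision problem C\&RP in polynomial time; that is, there is a polynomial-time computable map sending each instance $(G,k)$ of LC\&RP to an instance $(G',k')$ of C\&RP such that $k$ cops have a winning strategy in the Lazy Cops and Robbers with protection game on $G$ if and only if $k'$ cops have a winning strategy in the Cops and Robbers with protection game on $G'$.
   Context: All graphs are finite and undirected. An instance of Cops and Robbers with protection consists of a reflexive graph $G$ (every vertex has a loop) in which every edge (including loops) is designated, as part of the input, either protected or unprotected, together with a positive integer $k$. The game is played by $k$ cops and one robber with perfect information: first the cops choose initial vertices, then the robber chooses his initial vertex (possibly a vertex containing a cop). Play proceeds in rounds, each consisting of a cop turn followed by a robber turn; on the cop turn each cop stays or moves along an edge to an adjacent vertex (moving along a loop counts as traversing that edge), and on the robber turn the robber stays or moves to an adjacent vertex. Cops may travel along protected edges, but the cops win only if some cop comes to occupy the robber's vertex by traveling along an unprotected edge; in particular the robber may move onto a vertex containing a cop without immediately losing. The robber wins if the cops never win. C\&RP is the problem: given such $(G,k)$, do the $k$ cops have a winning strategy? Lazy Cops and Robbers with protection is the same game except that on each cop turn at most one cop moves to a new vertex (the cops collectively choose which cop, if any, moves). LC\&RP is the problem: given such $(G,k)$, do $k$ cops have a winning strategy in the lazy game? *)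

theory Defs
  imports Main "HOL-Computational_Algebra.Polynomial"
begin

section \<open>Deterministic multi-tape Turing machines and polynomial time\<close>

datatype dir = Left | Stay | Right

text \<open>
  The states are \<open>{..states M}\<close>, with start state \<open>0\<close> and halting state \<open>states M\<close>. The tape symbols are
  \<open>{..<symbols M}\<close>, where \<open>0\<close> is the blank and \<open>1\<close>, \<open>2\<close> represent the bits. The transition function
  maps a state and the list of scanned symbols (one per tape) to a successor state and, for each
  tape, the symbol to write and the head movement. Tape \<open>0\<close> holds the input, tape \<open>1\<close> the output.
\<close>

record tm =
  tapes :: nat
  symbols :: nat
  states :: nat
  trans :: "nat \<Rightarrow> nat list \<Rightarrow> nat \<times> (nat \<times> dir) list"

definition wf_tm :: "tm \<Rightarrow> bool" where
  "wf_tm M \<longleftrightarrow> tapes M \<ge> 2 \<and> symbols M \<ge> 3 \<and>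
     (\<forall>q < states M. \<forall>ss. length ss = tapes M \<and> set ss \<subseteq> {..<symbols M} \<longrightarrow>
        fst (trans M q ss) \<le> states M \<and>
        length (snd (trans M q ss)) = tapes M \<and>
        fst ` set (snd (trans M q ss)) \<subseteq> {..<symbols M})"

text \<open>A tape is a head position together with the contents of a two-way infinite array of cells.\<close>

type_synonym tape = "int \<times> (int \<Rightarrow> nat)"
type_synonym config = "nat \<times> tape list"

fun shift :: "dir \<Rightarrow> int" where
  "shift Left = -1"
| "shift Stay = 0"
| "shift Right = 1"

fun act :: "nat \<times> dir \<Rightarrow> tape \<Rightarrow> tape" where
  "act (s, d) (h, c) = (h + shift d, c(h := s))"

fun step :: "tm \<Rightarrow> config \<Rightarrow> config" where
  "step M (q, ts) =
     (if q < states M then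
        (let (q', as) = trans M q (map (\<lambda>(h, c). c h) ts) in (q', map2 act as ts))
      else (q, ts))"

definition word_cells :: "bool list \<Rightarrow> int \<Rightarrow> nat" where
  "word_cells w j =
     (if 0 \<le> j \<and> j < int (length w) then (if w ! nat j then 2 else 1) else 0)"

definition init_config :: "tm \<Rightarrow> bool list \<Rightarrow> config" where
  "init_config M w = (0, (0, word_cells w) # replicate (tapes M - 1) (0, word_cells []))"

definition computes_within :: "tm \<Rightarrow> nat \<Rightarrow> bool list \<Rightarrow> bool list \<Rightarrow> bool" where
  "computes_within M T x y \<longleftrightarrow>
     (\<exists>t \<le> T. \<exists>ts. (step M ^^ t) (init_config M x) = (states M, ts) \<and> snd (ts ! 1) = word_cells y)"

definition polytime_computable_on ::
  "'a set \<Rightarrow> ('a \<Rightarrow> bool list) \<Rightarrow> ('b \<Rightarrow> bool list) \<Rightarrow> ('a \<Rightarrow> 'b) \<Rightarrow> bool" where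
  "polytime_computable_on D enc enc' F \<longleftrightarrow>
     (\<exists>M. \<exists>p :: nat poly. wf_tm M \<and>
        (\<forall>x \<in> D. computes_within M (poly p (length (enc x))) (enc x) (enc' (F x))))"

section \<open>Reflexive graphs with protected edges\<close>

text \<open>An edge is the set of its endpoints; the loop at \<open>v\<close> is \<open>{v}\<close>, which equals \<open>{v, v}\<close>.\<close>

record 'v pgraph =
  verts :: "'v set"
  edges :: "'v set set"
  protected_edges :: "'v set set"

definition wf_pgraph :: "'v pgraph \<Rightarrow> bool" where
  "wf_pgraph G \<longleftrightarrow>
     finite (verts G) \<and> verts G \<noteq> {} \<and>
     edges G \<subseteq> {{u, v} | u v. u \<in> verts G \<and> v \<in> verts G} \<and>
     (\<forall>v \<in> verts G. {v} \<in> edges G) \<and>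
     protected_edges G \<subseteq> edges G"

section \<open>Cops and Robbers with protection\<close>

text \<open>
  The positions of the cops form a list, one entry per cop. Since every vertex has a loop, a cop that
  does not change its vertex is taken to traverse the loop there.
\<close>

definition cop_move :: "'v pgraph \<Rightarrow> 'v list \<Rightarrow> 'v list \<Rightarrow> bool" where
  "cop_move G C C' \<longleftrightarrow> list_all2 (\<lambda>u v. {u, v} \<in> edges G) C C'"

definition lazy_cop_move :: "'v pgraph \<Rightarrow> 'v list \<Rightarrow> 'v list \<Rightarrow> bool" where
  "lazy_cop_move G C C' \<longleftrightarrow> cop_move G C C' \<and> card {i. i < length C \<and> C' ! i \<noteq> C ! i} \<le> 1"

definition captures :: "'v pgraph \<Rightarrow> 'v list \<Rightarrow> 'v list \<Rightarrow> 'v \<Rightarrow> bool" where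
  "captures G C C' r \<longleftrightarrow>
     (\<exists>i < length C. C' ! i = r \<and> {C ! i, C' ! i} \<in> edges G - protected_edges G)"

definition robber_walk :: "'v pgraph \<Rightarrow> (nat \<Rightarrow> 'v) \<Rightarrow> bool" where
  "robber_walk G r \<longleftrightarrow> r 0 \<in> verts G \<and> (\<forall>t. {r t, r (Suc t)} \<in> edges G)"

text \<open>
  A strategy \<open>\<sigma>\<close> maps the robber's past positions to the next positions of the cops; the cops' own
  past positions are determined by \<open>\<sigma>\<close> and these. Thus \<open>\<sigma> []\<close> is the initial placement, and
  \<open>\<sigma> [r 0, \<dots>, r t]\<close> is the answer to the robber standing on \<open>r t\<close>. The parameter \<open>mv\<close> is the
  relation of admissible cop turns.
\<close>

definition winning_strategy ::
  "('v list \<Rightarrow> 'v list \<Rightarrow> bool) \<Rightarrow> 'v pgraph \<Rightarrow> nat \<Rightarrow> ('v list \<Rightarrow> 'v list) \<Rightarrow> bool" where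
  "winning_strategy mv G k \<sigma> \<longleftrightarrow>
     length (\<sigma> []) = k \<and> set (\<sigma> []) \<subseteq> verts G \<and>
     (\<forall>r. robber_walk G r \<longrightarrow>
        (\<forall>t. mv (\<sigma> (map r [0..<t])) (\<sigma> (map r [0..<Suc t]))) \<and>
        (\<exists>t. captures G (\<sigma> (map r [0..<t])) (\<sigma> (map r [0..<Suc t])) (r t)))"

definition cops_win :: "'v pgraph \<Rightarrow> nat \<Rightarrow> bool" where
  "cops_win G k \<longleftrightarrow> (\<exists>\<sigma>. winning_strategy (cop_move G) G k \<sigma>)"

definition lazy_cops_win :: "'v pgraph \<Rightarrow> nat \<Rightarrow> bool" where
  "lazy_cops_win G k \<longleftrightarrow> (\<exists>\<sigma>. winning_strategy (lazy_cop_move G) G k \<sigma>)"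

section \<open>Instances and their encoding\<close>

definition instances :: "(nat pgraph \<times> nat) set" where
  "instances = {(G, k). wf_pgraph G \<and> (\<exists>n. verts G = {..<n}) \<and> k \<ge> 1}"

text \<open>Binary representation, least significant bit first, without leading zeros.\<close>

fun nat_bits :: "nat \<Rightarrow> bool list" where
  "nat_bits n = (if n = 0 then [] else odd n # nat_bits (n div 2))"

declare nat_bits.simps [simp del]

text \<open>
  The number of vertices in unary, then the adjacency matrix row by row with two bits per entry
  (edge, protected edge), then the number of cops in binary.
\<close>

definition encode :: "nat pgraph \<times> nat \<Rightarrow> bool list" where
  "encode = (\<lambda>(G, k). let n = card (verts G) in
     replicate n True @ [False] @
     concat (map (\<lambda>u. concat (map (\<lambda>v. [{u, v} \<in> edges G, {u, v} \<in> protected_edges G]) [0..<n]))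
       [0..<n]) @
     nat_bits k)"

lemma nat_bits_inj: "nat_bits m = nat_bits n \<Longrightarrow> m = n"
proof (induction m arbitrary: n rule: less_induct)
  case (less m)
  show ?case
  proof (cases "m = 0 \<or> n = 0")
    case True
    then show ?thesis
      using less.prems by (auto simp: nat_bits.simps[of m] nat_bits.simps[of n] split: if_splits)
  next
    case False
    then have "odd m = odd n" "nat_bits (m div 2) = nat_bits (n div 2)"
      using less.prems by (auto simp: nat_bits.simps[of m] nat_bits.simps[of n])
    moreover from this have "m div 2 = n div 2"
      using False less.IH[of "m div 2" "n div 2"] by simp
    ultimately show ?thesis
      by (metis bit_eq_rec)
  qed
qed

lemma concat_map_uniform_inj:
  assumes "concat (map f xs) @ ys = concat (map g xs) @ zs"
    and "\<And>x. x \<in> set xs \<Longrightarrow> length (f x) = length (g x)"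
  shows "(\<forall>x \<in> set xs. f x = g x) \<and> ys = zs"
  using assms by (induction xs) auto

lemma replicate_True_inj:
  "replicate m True @ False # xs = replicate n True @ False # ys \<Longrightarrow> m = n \<and> xs = ys"
proof (induction m arbitrary: n)
  case 0
  then show ?case by (cases n) auto
next
  case (Suc m)
  then show ?case by (cases n) auto
qed

lemma inj_on_encode: "inj_on encode instances"
proof (rule inj_onI, clarify)
  fix G k H l
  assume I: "(G, k) \<in> instances" "(H, l) \<in> instances" and eq: "encode (G, k) = encode (H, l)"
  obtain m n where V: "verts G = {..<m}" "verts H = {..<n}"
    using I by (auto simp: instances_def)
  define entry where
    "entry K u v = [{u, v} \<in> edges K, {u, v} \<in> protected_edges K]" for K :: "nat pgraph" and u v
  define row where "row K u = concat (map (entry K u) [0..<m])" for K u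
  have mn: "m = n"
    using eq V by (auto simp: encode_def dest: replicate_True_inj)
  have len: "length (entry G u v) = length (entry H u v)" for u v
    by (simp add: entry_def)
  have "length (row G u) = length (row H u)" for u
    by (simp add: row_def entry_def length_concat comp_def)
  moreover have "concat (map (row G) [0..<m]) @ nat_bits k = concat (map (row H) [0..<m]) @ nat_bits l"
    using eq V mn by (simp add: encode_def row_def[abs_def] entry_def[abs_def])
  ultimately have *: "(\<forall>u \<in> set [0..<m]. row G u = row H u) \<and> nat_bits k = nat_bits l"
    by (intro concat_map_uniform_inj)
  then have k: "nat_bits k = nat_bits l" by blast
  have entry_eq: "entry G u v = entry H u v" if "u < m" "v < m" for u v
  proof -
    have "row G u = row H u" using * that by simp
    then have "concat (map (entry G u) [0..<m]) @ [] = concat (map (entry H u) [0..<m]) @ []"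
      by (simp only: row_def)
    then have "(\<forall>v \<in> set [0..<m]. entry G u v = entry H u v) \<and> [] = ([] :: bool list)"
      by (rule concat_map_uniform_inj) (rule len)
    then show ?thesis using that by simp
  qed
  have entries: "({u, v} \<in> edges G \<longleftrightarrow> {u, v} \<in> edges H) \<and>
      ({u, v} \<in> protected_edges G \<longleftrightarrow> {u, v} \<in> protected_edges H)" if "u < m" "v < m" for u v
    using entry_eq[OF that] by (simp add: entry_def)
  have sub: "edges K \<subseteq> {{u, v} | u v. u < m \<and> v < m}" "protected_edges K \<subseteq> edges K"
    if "K \<in> {G, H}" for K
    using I V mn that by (auto simp: instances_def wf_pgraph_def)
  have E: "e \<in> edges G \<longleftrightarrow> e \<in> edges H" for e
  proof (cases "\<exists>u v. u < m \<and> v < m \<and> e = {u, v}")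
    case True
    then show ?thesis using entries by blast
  next
    case False
    then show ?thesis using sub(1)[of G] sub(1)[of H] by blast
  qed
  have P: "e \<in> protected_edges G \<longleftrightarrow> e \<in> protected_edges H" for e
  proof (cases "\<exists>u v. u < m \<and> v < m \<and> e = {u, v}")
    case True
    then show ?thesis using entries by blast
  next
    case False
    then show ?thesis using sub[of G] sub[of H] by blast
  qed
  from E P have "edges G = edges H" "protected_edges G = protected_edges H"
    by blast+
  then show "G = H \<and> k = l"
    using V mn nat_bits_inj[OF k] by simp
qed

end

theory Submission
  imports Defs
begin

text \<open>
  With \<open>n\<close> vertices, more than \<open>n\<close> lazy cops are no better than \<open>n\<close>: if some vertex has no unprotected
  edge the robber rests there, and otherwise \<open>n\<close> cops win at once. So let \<open>K = min k n\<close>. The new graph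
  has \<open>K\<close> copies of the vertex set, called tracks, one for each cop, and two further cops. On a track
  every vertex comes in four versions, carrying a flag. The \<^emph>\<open>declaring\<close> cop announces which track may
  move, and thereby prescribes the flag that each cop must show; the adjacency of the versions is chosen
  such that passing from prescribed flags to prescribed flags lets at most one cop change its vertex.

  The robber enforces this with \<^emph>\<open>check\<close> vertices. They are pairwise adjacent and adjacent to his copy of
  the original graph, and all of them are threatened by unprotected edges exactly when there is one cop
  on each track, showing the prescribed flag, one declaring cop and one cop at home. If the cops deviate,
  the robber moves to a check vertex that is not threatened and waits there until the cops are in order
  again; then he enters the original graph anew, and all the cops have gained is another choice of
  initial positions. If he moves to a check vertex without a reason, he is captured at once. Should he
  enter the tracks, the home cop moves to the hub and captures him one turn later.

  Adjacency in the new graph depends on the types of two vertices, the order of their tracks and the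
  relation of their original vertices only, so a Turing machine writes its matrix by nested loops.
\<close>

section \<open>Positional form of the game\<close>

text \<open>The minimum with \<open>n\<close> answers to the encoding: \<open>k\<close> is written
  in binary, so \<open>k\<close> tracks could be exponentially many vertices. Each cop's moves
  depend on adjacency alone, so no graph can forbid several cops to move at once; it can only make
  joint moves punishable, and the robber has to do the punishing. The parity bit resolves a
  conflict. The lazy player may pick another cop in every round, so a cop must be able to move in
  the very turn in which its track becomes marked; demanding the mark both before and after the turn
  would cost a round. Demanding it only before or after would free the old and the new track
  together. Parity selects one of the two, and the order of the tracks breaks the symmetry: if the
  flags ignored the order, equal parities would free both. Strategies are replaced by the least
  fixed point \<open>forced\<close> over positions with the cops to move. The cops' half of the
  equivalence is then a rule induction along a lazy win, and the robber's half an invariant that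
  refutes every derivation of \<open>forced\<close>.\<close>

inductive forced :: "('v list \<Rightarrow> 'v list \<Rightarrow> bool) \<Rightarrow> 'v pgraph \<Rightarrow> 'v list \<Rightarrow> 'v \<Rightarrow> bool"
  for mv G where
  capture: "mv C C' \<Longrightarrow> captures G C C' r \<Longrightarrow> forced mv G C r"
| advance: "mv C C' \<Longrightarrow> (\<And>r'. {r, r'} \<in> edges G \<Longrightarrow> forced mv G C' r') \<Longrightarrow> forced mv G C r"

lemma wf_edge_verts: "wf_pgraph G \<Longrightarrow> {u, v} \<in> edges G \<Longrightarrow> u \<in> verts G \<and> v \<in> verts G"
  unfolding wf_pgraph_def by (auto simp: doubleton_eq_iff subset_iff)

lemma wf_loop: "wf_pgraph G \<Longrightarrow> v \<in> verts G \<Longrightarrow> {v} \<in> edges G"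
  by (simp add: wf_pgraph_def)

lemma wf_verts_nonempty: "wf_pgraph G \<Longrightarrow> verts G \<noteq> {}"
  by (simp add: wf_pgraph_def)

text \<open>From a position that is not forced the robber can answer each move of
  \<open>\<sigma>\<close> by a vertex that is again not forced. Choosing such answers for ever
  yields a walk along which \<open>\<sigma>\<close> never captures him.\<close>

lemma winning_strategy_forced:
  assumes wf: "wf_pgraph G" and win: "winning_strategy mv G k \<sigma>" and r0: "r0 \<in> verts G"
  shows "forced mv G (\<sigma> []) r0"
proof (rule ccontr)
  assume nf: "\<not> forced mv G (\<sigma> []) r0"
  define nxt where
    "nxt h = (SOME x. {last h, x} \<in> edges G \<and> \<not> forced mv G (\<sigma> h) x)" for h
  define H where "H t = ((\<lambda>h. h @ [nxt h]) ^^ t) [r0]" for t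
  define r where "r t = last (H t)" for t
  have H_Suc: "H (Suc t) = H t @ [nxt (H t)]" and H_0: "H 0 = [r0]" for t
    by (simp_all add: H_def)
  have H_eq: "H t = map r [0..<Suc t]" for t
  proof (induction t)
    case (Suc t)
    moreover have "r (Suc t) = nxt (H t)" by (simp add: r_def H_Suc)
    ultimately show ?case by (simp add: H_Suc)
  qed (simp add: H_0 r_def)
  have r_Suc: "r (Suc t) = nxt (map r [0..<Suc t])" for t
  proof -
    have "r (Suc t) = nxt (H t)" by (simp add: r_def H_Suc)
    then show ?thesis by (rule H_eq[of t, THEN subst])
  qed
  have mv_walk: "mv (\<sigma> (map w [0..<t])) (\<sigma> (map w [0..<Suc t]))" if "robber_walk G w" for w t
    using win that unfolding winning_strategy_def by blast
  have main: "\<not> forced mv G (\<sigma> (map r [0..<t])) (r t) \<and> (\<forall>s<t. {r s, r (Suc s)} \<in> edges G) \<and>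
      r t \<in> verts G \<and> (mv (\<sigma> (map r [0..<t])) (\<sigma> (map r [0..<Suc t])))" for t
  proof (induction t)
    case 0
    have r00: "r 0 = r0" by (simp add: r_def H_0)
    have "robber_walk G (\<lambda>_. r0)"
      using r0 wf by (simp add: robber_walk_def wf_loop)
    from mv_walk[OF this, of 0] show ?case using nf r0 r00 by simp
  next
    case (Suc t)
    let ?h = "map r [0..<Suc t]"
    have "\<exists>x. {last ?h, x} \<in> edges G \<and> \<not> forced mv G (\<sigma> ?h) x"
    proof (rule ccontr)
      assume "\<not> ?thesis"
      then have all: "forced mv G (\<sigma> ?h) r'" if "{r t, r'} \<in> edges G" for r'
        using that by simp
      have mv: "mv (\<sigma> (map r [0..<t])) (\<sigma> ?h)" using Suc by blast
      have "forced mv G (\<sigma> (map r [0..<t])) (r t)"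
        by (rule forced.advance[where C' = "\<sigma> ?h"]) (fact mv all)+
      then show False using Suc by blast
    qed
    then have "{last ?h, r (Suc t)} \<in> edges G \<and> \<not> forced mv G (\<sigma> ?h) (r (Suc t))"
      unfolding r_Suc nxt_def by (rule someI_ex)
    then have nxt: "{r t, r (Suc t)} \<in> edges G" "\<not> forced mv G (\<sigma> ?h) (r (Suc t))" by simp_all
    then have walk: "\<forall>s<Suc t. {r s, r (Suc s)} \<in> edges G" and v: "r (Suc t) \<in> verts G"
      using Suc wf_edge_verts[OF wf nxt(1)] by (simp_all add: less_Suc_eq)
    \<comment> \<open>Admissible answers of \<open>\<sigma>\<close> are granted along infinite
      robber walks only, so the finite history is continued by resting on its last vertex.\<close>
    define w where "w s = (if s \<le> Suc t then r s else r (Suc t))" for s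
    have "r 0 \<in> verts G" using r0 by (simp add: r_def H_0)
    moreover have "{w s, w (Suc s)} \<in> edges G" for s
      using walk wf_loop[OF wf v] by (cases "s < Suc t") (auto simp: w_def)
    ultimately have "robber_walk G w"
      by (simp add: robber_walk_def w_def)
    then have "mv (\<sigma> (map w [0..<Suc t])) (\<sigma> (map w [0..<Suc (Suc t)]))"
      by (rule mv_walk)
    moreover have "map w [0..<Suc t] = map r [0..<Suc t]"
      "map w [0..<Suc (Suc t)] = map r [0..<Suc (Suc t)]"
      by (auto simp: w_def simp del: upt_Suc)
    ultimately show ?case using nxt walk v by (simp del: upt_Suc)
  qed
  have "r 0 \<in> verts G" "\<And>t. {r t, r (Suc t)} \<in> edges G"
    using main[of 0] main lessI by blast+
  then have "robber_walk G r"
    by (simp add: robber_walk_def)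
  then obtain t where "captures G (\<sigma> (map r [0..<t])) (\<sigma> (map r [0..<Suc t])) (r t)"
    using win unfolding winning_strategy_def by blast
  moreover have "mv (\<sigma> (map r [0..<t])) (\<sigma> (map r [0..<Suc t]))" using main by blast
  ultimately have "forced mv G (\<sigma> (map r [0..<t])) (r t)"
    by (intro forced.capture[where C' = "\<sigma> (map r [0..<Suc t])"])
  then show False using main by blast
qed

lemma map_upt_shift: "map w [0..<Suc t] = w 0 # map (\<lambda>s. w (Suc s)) [0..<t]"
  by (induction t) auto

text \<open>The strategy is assembled along the derivation of \<open>forced\<close>. Since
  \<open>winning_strategy\<close> asks for admissible moves at all times, the hypothesis on
  \<open>mv\<close> lets the cops rest for ever after the capture.\<close>

lemma forced_strategy:
  assumes wf: "wf_pgraph G" and stay: "\<forall>C C'. mv C C' \<longrightarrow> mv C' C'"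
    and "forced mv G C r"
  shows "\<exists>\<tau>. \<tau> [] = C \<and> (\<forall>w. robber_walk G w \<and> w 0 = r \<longrightarrow>
      (\<forall>t. mv (\<tau> (map w [0..<t])) (\<tau> (map w [0..<Suc t]))) \<and>
      (\<exists>t. captures G (\<tau> (map w [0..<t])) (\<tau> (map w [0..<Suc t])) (w t)))"
  using assms(3)
proof (induction rule: forced.induct)
  case (capture C C' r)
  let ?\<tau> = "\<lambda>h. if h = [] then C else C'"
  have "mv (?\<tau> (map w [0..<t])) (?\<tau> (map w [0..<Suc t]))" for w :: "nat \<Rightarrow> 'a" and t
    using capture(1) stay by auto
  moreover have "captures G (?\<tau> (map w [0..<0])) (?\<tau> (map w [0..<Suc 0])) (w 0)" if "w 0 = r" for w
    using capture(2) that by simp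
  ultimately have "(\<forall>t. mv (?\<tau> (map w [0..<t])) (?\<tau> (map w [0..<Suc t]))) \<and>
      (\<exists>t. captures G (?\<tau> (map w [0..<t])) (?\<tau> (map w [0..<Suc t])) (w t))" if "w 0 = r" for w
    using that by blast
  then show ?case by (intro exI[of _ ?\<tau>]) simp
next
  case (advance C C' r)
  then obtain T where T: "\<And>r'. {r, r'} \<in> edges G \<Longrightarrow> T r' [] = C' \<and>
      (\<forall>w. robber_walk G w \<and> w 0 = r' \<longrightarrow>
      (\<forall>t. mv (T r' (map w [0..<t])) (T r' (map w [0..<Suc t]))) \<and>
      (\<exists>t. captures G (T r' (map w [0..<t])) (T r' (map w [0..<Suc t])) (w t)))"
    by metis
  \<comment> \<open>A history longer than one vertex is handed, without its first vertex, to the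
    strategy that the induction provides for the robber's reply \<open>hd ys\<close>.\<close>
  define \<tau> where "\<tau> h = (case h of [] \<Rightarrow> C | x # ys \<Rightarrow> if ys = [] then C' else T (hd ys) ys)" for h
  have "(\<forall>t. mv (\<tau> (map w [0..<t])) (\<tau> (map w [0..<Suc t]))) \<and>
      (\<exists>t. captures G (\<tau> (map w [0..<t])) (\<tau> (map w [0..<Suc t])) (w t))"
    if w: "robber_walk G w" "w 0 = r" for w
  proof -
    let ?w = "\<lambda>s. w (Suc s)"
    have e: "{r, ?w 0} \<in> edges G" using w by (auto simp: robber_walk_def)
    have w': "robber_walk G ?w"
      using w(1) e wf_edge_verts[OF wf e] by (auto simp: robber_walk_def)
    have \<tau>: "\<tau> (map w [0..<Suc t]) = T (?w 0) (map ?w [0..<t])" for t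
    proof (cases t)
      case 0
      then show ?thesis using T[OF e] by (simp add: \<tau>_def)
    next
      case (Suc s)
      then show ?thesis
        unfolding map_upt_shift \<tau>_def by (simp add: map_upt_shift[of _ s] del: upt_Suc)
    qed
    have "mv (\<tau> (map w [0..<t])) (\<tau> (map w [0..<Suc t]))" for t
    proof (cases t)
      case 0
      then show ?thesis using advance(1) by (simp add: \<tau>_def)
    next
      case (Suc s)
      then show ?thesis using T[OF e] w' by (simp add: \<tau> del: upt_Suc)
    qed
    moreover obtain t where
      "captures G (T (?w 0) (map ?w [0..<t])) (T (?w 0) (map ?w [0..<Suc t])) (?w t)"
      using T[OF e] w' by blast
    then have "captures G (\<tau> (map w [0..<Suc t])) (\<tau> (map w [0..<Suc (Suc t)])) (w (Suc t))"
      by (simp only: \<tau>)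
    ultimately show ?thesis by blast
  qed
  moreover have "\<tau> [] = C" by (simp add: \<tau>_def)
  ultimately show ?case by blast
qed

lemma ex_winning_strategy_iff:
  assumes wf: "wf_pgraph G" and stay: "\<forall>C C'. mv C C' \<longrightarrow> mv C' C'"
  shows "(\<exists>\<sigma>. winning_strategy mv G k \<sigma>) \<longleftrightarrow>
    (\<exists>C. length C = k \<and> set C \<subseteq> verts G \<and> (\<forall>r \<in> verts G. forced mv G C r))"
proof
  assume "\<exists>\<sigma>. winning_strategy mv G k \<sigma>"
  then obtain \<sigma> where "winning_strategy mv G k \<sigma>" ..
  then show "\<exists>C. length C = k \<and> set C \<subseteq> verts G \<and> (\<forall>r \<in> verts G. forced mv G C r)"
    using winning_strategy_forced[OF wf] by (intro exI[of _ "\<sigma> []"]) (auto simp: winning_strategy_def)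
next
  assume "\<exists>C. length C = k \<and> set C \<subseteq> verts G \<and> (\<forall>r \<in> verts G. forced mv G C r)"
  then obtain C where C: "length C = k" "set C \<subseteq> verts G" "\<forall>r \<in> verts G. forced mv G C r"
    by blast
  have "\<forall>r \<in> verts G. \<exists>\<tau>. \<tau> [] = C \<and> (\<forall>w. robber_walk G w \<and> w 0 = r \<longrightarrow>
      (\<forall>t. mv (\<tau> (map w [0..<t])) (\<tau> (map w [0..<Suc t]))) \<and>
      (\<exists>t. captures G (\<tau> (map w [0..<t])) (\<tau> (map w [0..<Suc t])) (w t)))"
    by (intro ballI forced_strategy[OF wf stay]) (use C(3) in simp)
  from bchoice[OF this] obtain T where T: "\<forall>r \<in> verts G. T r [] = C \<and> (\<forall>w. robber_walk G w \<and> w 0 = r \<longrightarrow>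
      (\<forall>t. mv (T r (map w [0..<t])) (T r (map w [0..<Suc t]))) \<and>
      (\<exists>t. captures G (T r (map w [0..<t])) (T r (map w [0..<Suc t])) (w t)))"
    by blast
  \<comment> \<open>All strategies \<open>T r\<close> begin with the same placement
    \<open>C\<close>, so the choice among them can wait until the robber has shown his initial
    vertex \<open>hd h\<close>.\<close>
  define \<sigma> where "\<sigma> h = (if h = [] then C else T (hd h) h)" for h
  have "(\<forall>t. mv (\<sigma> (map w [0..<t])) (\<sigma> (map w [0..<Suc t]))) \<and>
      (\<exists>t. captures G (\<sigma> (map w [0..<t])) (\<sigma> (map w [0..<Suc t])) (w t))"
    if w: "robber_walk G w" for w
  proof -
    have w0: "w 0 \<in> verts G" using w by (simp add: robber_walk_def)
    have "\<sigma> (map w [0..<t]) = T (w 0) (map w [0..<t])" for t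
      using T w0 by (cases t) (auto simp: \<sigma>_def hd_map simp del: upt_Suc)
    then show ?thesis using T w w0 by (simp only: bex_simps) blast
  qed
  moreover have "\<sigma> [] = C" by (simp add: \<sigma>_def)
  ultimately show "\<exists>\<sigma>. winning_strategy mv G k \<sigma>"
    using C by (intro exI[of _ \<sigma>]) (simp add: winning_strategy_def)
qed

lemma cop_move_verts:
  assumes "wf_pgraph G" "cop_move G C C'"
  shows "length C' = length C" "set C \<subseteq> verts G" "set C' \<subseteq> verts G"
proof -
  have "length C' = length C" and e: "\<forall>i < length C. {C ! i, C' ! i} \<in> edges G"
    using assms(2) by (auto simp: cop_move_def list_all2_conv_all_nth)
  moreover from e have "\<forall>i < length C. C ! i \<in> verts G \<and> C' ! i \<in> verts G"
    using wf_edge_verts[OF assms(1)] by blast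
  ultimately show "length C' = length C" "set C \<subseteq> verts G" "set C' \<subseteq> verts G"
    by (auto simp: in_set_conv_nth)
qed

lemma cop_move_refl:
  assumes "wf_pgraph G" "set C \<subseteq> verts G"
  shows "cop_move G C C"
  using assms by (auto simp: cop_move_def list_all2_conv_all_nth intro!: wf_loop)

lemma lazy_cop_move_refl:
  assumes "wf_pgraph G" "set C \<subseteq> verts G"
  shows "lazy_cop_move G C C"
  using cop_move_refl[OF assms] by (simp add: lazy_cop_move_def)

lemma cops_win_iff:
  assumes "wf_pgraph G"
  shows "cops_win G k \<longleftrightarrow>
    (\<exists>C. length C = k \<and> set C \<subseteq> verts G \<and> (\<forall>r \<in> verts G. forced (cop_move G) G C r))"
proof -
  have "\<forall>C C'. cop_move G C C' \<longrightarrow> cop_move G C' C'"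
    using cop_move_refl[OF assms] cop_move_verts[OF assms] by blast
  then show ?thesis unfolding cops_win_def by (rule ex_winning_strategy_iff[OF assms])
qed

lemma lazy_cops_win_iff:
  assumes "wf_pgraph G"
  shows "lazy_cops_win G k \<longleftrightarrow>
    (\<exists>C. length C = k \<and> set C \<subseteq> verts G \<and> (\<forall>r \<in> verts G. forced (lazy_cop_move G) G C r))"
proof -
  have "\<forall>C C'. lazy_cop_move G C C' \<longrightarrow> lazy_cop_move G C' C'"
    using lazy_cop_move_refl[OF assms] cop_move_verts[OF assms] unfolding lazy_cop_move_def by blast
  then show ?thesis unfolding lazy_cops_win_def by (rule ex_winning_strategy_iff[OF assms])
qed

lemma cop_move_update:
  assumes "wf_pgraph G" "set C \<subseteq> verts G" "i < length C" "{C ! i, x} \<in> edges G"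
  shows "cop_move G C (C[i := x])"
  using assms by (auto simp: cop_move_def list_all2_conv_all_nth nth_list_update intro!: wf_loop)

lemma lazy_cop_move_update:
  assumes "wf_pgraph G" "set C \<subseteq> verts G" "i < length C" "{C ! i, x} \<in> edges G"
  shows "lazy_cop_move G C (C[i := x])"
proof -
  have "{j. j < length C \<and> C[i := x] ! j \<noteq> C ! j} \<subseteq> {i}"
    by (auto intro: ccontr)
  then have "card {j. j < length C \<and> C[i := x] ! j \<noteq> C ! j} \<le> card {i}"
    by (intro card_mono) auto
  then show ?thesis using cop_move_update[OF assms] by (simp add: lazy_cop_move_def)
qed

lemma forced_if_threatened:
  assumes "mv C (C[i := x])" "i < length C" "{C ! i, x} \<in> edges G - protected_edges G"
  shows "forced mv G C x"
  using assms by (intro forced.capture[of mv C "C[i := x]"]) (auto simp: captures_def)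

section \<open>Vertices without unprotected edges, and surplus cops\<close>

lemma not_cops_win_if_protected:
  assumes wf: "wf_pgraph G" and v: "v \<in> verts G"
    and prot: "\<And>u. {u, v} \<notin> edges G - protected_edges G"
  shows "\<not> cops_win G k" "\<not> lazy_cops_win G k"
proof -
  have *: "\<not> forced mv G C r" if "r = v" for mv C r
  proof
    assume "forced mv G C r"
    then show False using that
    proof (induction rule: forced.induct)
      case (capture C C' r)
      then show ?case using prot by (auto simp: captures_def)
    next
      case (advance C C' r)
      then show ?case using wf_loop[OF wf v] by simp
    qed
  qed
  show "\<not> cops_win G k" "\<not> lazy_cops_win G k"
    using * v by (auto simp: cops_win_iff[OF wf] lazy_cops_win_iff[OF wf])
qed

lemma lazy_cops_win_many:
  assumes wf: "wf_pgraph G" and V: "verts G = {..<n}" and k: "n \<le> k"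
  shows "lazy_cops_win G k \<longleftrightarrow> (\<forall>v<n. \<exists>u. {u, v} \<in> edges G - protected_edges G)"
proof
  assume win: "lazy_cops_win G k"
  show "\<forall>v<n. \<exists>u. {u, v} \<in> edges G - protected_edges G"
  proof (intro allI impI, rule ccontr)
    fix v assume "v < n" "\<not> (\<exists>u. {u, v} \<in> edges G - protected_edges G)"
    then have "\<not> lazy_cops_win G k"
      using V by (intro not_cops_win_if_protected(2)[OF wf, of v]) auto
    then show False using win by simp
  qed
next
  assume u: "\<forall>v<n. \<exists>u. {u, v} \<in> edges G - protected_edges G"
  \<comment> \<open>The cop with index \<open>x\<close> stands on \<open>x\<close>, so an
    unprotected edge \<open>{x, r}\<close> names the capturing cop; surplus cops are parked on
    vertex 0.\<close>
  let ?C = "[0..<n] @ replicate (k - n) 0"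
  have "n > 0" using wf_verts_nonempty[OF wf] unfolding V by (cases n) simp_all
  then have C: "set ?C \<subseteq> verts G" unfolding V by (simp add: subset_iff)
  have "forced (lazy_cop_move G) G ?C r" if r: "r \<in> verts G" for r
  proof -
    obtain x where x: "{x, r} \<in> edges G - protected_edges G" using u r V by auto
    then have "x < n" using wf_edge_verts[OF wf, of x r] V by simp
    then have "?C ! x = x" "x < length ?C" by (simp_all add: nth_append)
    moreover from this have "lazy_cop_move G ?C (?C[x := r])"
      using x by (intro lazy_cop_move_update[OF wf C]) simp_all
    ultimately show ?thesis
      using x by (metis forced_if_threatened)
  qed
  moreover have "length ?C = k" using k by simp
  ultimately show "lazy_cops_win G k"
    using C unfolding lazy_cops_win_iff[OF wf] by (intro exI[of _ ?C] conjI ballI)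
qed

lemma forced_append:
  assumes wf: "wf_pgraph G" and "forced (cop_move G) G C r" "set D \<subseteq> verts G"
  shows "forced (cop_move G) G (C @ D) r"
  using assms(2)
proof (induction rule: forced.induct)
  case (capture C C' r)
  then have "cop_move G (C @ D) (C' @ D)"
    using cop_move_refl[OF wf assms(3)] unfolding cop_move_def by (intro list_all2_appendI)
  moreover have "captures G (C @ D) (C' @ D) r"
  proof -
    obtain i where "i < length C" "C' ! i = r" "{C ! i, C' ! i} \<in> edges G - protected_edges G"
      using capture(2) by (auto simp: captures_def)
    then show ?thesis
      using cop_move_verts(1)[OF wf capture(1)] unfolding captures_def
      by (intro exI[of _ i]) (simp add: nth_append)
  qed
  ultimately show ?case by (rule forced.capture)
next
  case (advance C C' r)
  then have "cop_move G (C @ D) (C' @ D)"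
    using cop_move_refl[OF wf assms(3)] unfolding cop_move_def by (intro list_all2_appendI)
  then show ?case using advance.IH by (rule forced.advance)
qed

lemma cops_win_mono:
  assumes wf: "wf_pgraph G" and "cops_win G k" "k \<le> l"
  shows "cops_win G l"
proof -
  obtain C where C: "length C = k" "set C \<subseteq> verts G" "\<forall>r \<in> verts G. forced (cop_move G) G C r"
    using assms(2) by (auto simp: cops_win_iff[OF wf])
  obtain v where v: "v \<in> verts G" using wf_verts_nonempty[OF wf] by blast
  let ?D = "replicate (l - k) v"
  have "set ?D \<subseteq> verts G" using v by auto
  then have "\<forall>r \<in> verts G. forced (cop_move G) G (C @ ?D) r"
    using C(3) forced_append[OF wf] by blast
  moreover have "length (C @ ?D) = l" "set (C @ ?D) \<subseteq> verts G"
    using C assms(3) v by auto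
  ultimately show ?thesis
    unfolding cops_win_iff[OF wf] by blast
qed

section \<open>The reduction\<close>

text \<open>
  \<open>Cop s b\<close> are the four versions of a track vertex: \<open>s\<close> marks the track that may move, \<open>b\<close> is a parity
  bit. \<open>Decl b\<close> on track \<open>j\<close> declares \<open>j\<close> with parity \<open>b\<close>. The check \<open>Chk s b\<close> of a track tests for the
  flag \<open>(s, b)\<close> unless the declaration prescribes another one, and \<open>TrackChk\<close>, \<open>DeclChk\<close>, \<open>HomeChk\<close>
  test whether a cop is on the track, declaring, and at home. \<open>Rob\<close> is the robber's copy of the original
  graph. All tags are combined with all tracks and all original vertices, which makes the graph a uniform
  product; a component that has no meaning for a tag only produces twins.
\<close>

datatype tag =
    Cop bool bool
  | Decl bool
  | Home
  | Hub
  | Chk bool bool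
  | TrackChk
  | DeclChk
  | HomeChk
  | Rob

definition tags :: "tag list" where
  "tags = [Cop False False, Cop False True, Cop True False, Cop True True, Decl False, Decl True,
     Home, Hub, Chk False False, Chk False True, Chk True False, Chk True True,
     TrackChk, DeclChk, HomeChk, Rob]"

lemma length_tags: "length tags = 16"
  by (simp add: tags_def)

lemma in_set_tags: "t \<in> set tags"
proof (cases t)
  case (Cop s b)
  then show ?thesis by (cases s; cases b) (simp_all add: tags_def)
next
  case (Decl b)
  then show ?thesis by (cases b) (simp_all add: tags_def)
next
  case (Chk s b)
  then show ?thesis by (cases s; cases b) (simp_all add: tags_def)
qed (simp_all add: tags_def)

fun chk :: "tag \<Rightarrow> bool" where
  "chk (Chk s b) = True"
| "chk TrackChk = True"
| "chk DeclChk = True"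
| "chk HomeChk = True"
| "chk _ = False"

text \<open>The values are also the tape symbols by which the Turing machine compares loop indices.\<close>

definition cmp :: "nat \<Rightarrow> nat \<Rightarrow> nat" where
  "cmp i j = (if j < i then 1 else if j = i then 2 else 3)"

lemma cmp_flip: "4 - cmp i j = cmp j i"
  by (simp add: cmp_def)

lemma cmp_eq_2: "cmp i j = 2 \<longleftrightarrow> i = j"
  by (simp add: cmp_def)

text \<open>
  \<open>required (cmp i j) b\<close> is the flag that the declaration of track \<open>j\<close> with parity \<open>b\<close> prescribes on track
  \<open>i\<close>. When the declaration changes from \<open>j\<close> to \<open>j' > j\<close>, track \<open>j\<close> is movable iff the two parities differ
  and track \<open>j'\<close> is movable iff they agree, hence never both.
\<close>

definition required :: "nat \<Rightarrow> bool \<Rightarrow> bool \<times> bool" where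
  "required c b = (c = 2, if c = 3 then \<not> b else b)"

fun movable :: "bool \<times> bool \<Rightarrow> bool \<times> bool \<Rightarrow> bool" where
  "movable (s, b) (s', b') \<longleftrightarrow> s \<and> s' \<or> (s \<or> s') \<and> b = b'"

text \<open>A movable track carries the mark before or after the change, so it is \<open>j\<close>
  or \<open>j'\<close>. If these differ, \<open>required\<close> reverses the parity on the smaller
  of the two only: equal parities free one track, different parities the other.\<close>

lemma movable_unique:
  assumes "movable (required (cmp i j) b) (required (cmp i j') b')"
    and "movable (required (cmp i' j) b) (required (cmp i' j') b')"
  shows "i = i'"
  using assms by (auto simp: required_def cmp_def split: if_splits)

text \<open>
  The argument \<open>c\<close> is \<open>cmp i j\<close> for the tracks \<open>i\<close>, \<open>j\<close> of the two vertices, so \<open>4 - c\<close> is \<open>cmp j i\<close>; \<open>ue\<close>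
  tells whether the original vertices are joined by an unprotected edge. A hub over \<open>u\<close> threatens only
  those robber vertices that a track vertex over \<open>u\<close> threatens: a robber vertex without unprotected
  edges must stay safe even if there are more than \<open>K + 2\<close> cops.
\<close>

definition threat :: "tag \<Rightarrow> tag \<Rightarrow> nat \<Rightarrow> bool \<Rightarrow> bool" where
  "threat t t' c ue = (case t of
     Cop s b \<Rightarrow> (case t' of Rob \<Rightarrow> ue | TrackChk \<Rightarrow> c = 2 | Chk s' b' \<Rightarrow> c = 2 \<and> s' = s \<and> b' = b | _ \<Rightarrow> False)
   | Decl b \<Rightarrow> (case t' of DeclChk \<Rightarrow> True | Chk s' b' \<Rightarrow> required (4 - c) b \<noteq> (s', b') | _ \<Rightarrow> False)
   | Home \<Rightarrow> t' = HomeChk \<or> t' = Home \<or> t' = Hub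
   | Hub \<Rightarrow> (case t' of Cop _ _ \<Rightarrow> True | Decl _ \<Rightarrow> True | Rob \<Rightarrow> ue | Hub \<Rightarrow> True | _ \<Rightarrow> False)
   | _ \<Rightarrow> False)"

text \<open>Edges are undirected, so every threat also works backwards. Against a robber on a check
  or in his copy of the original graph this adds nothing, because nothing is threatened from those
  tags.\<close>

definition unprot :: "tag \<Rightarrow> tag \<Rightarrow> nat \<Rightarrow> bool \<Rightarrow> bool" where
  "unprot t t' c ue \<longleftrightarrow> threat t t' c ue \<or> threat t' t (4 - c) ue"

text \<open>Edges between two \<open>Rob\<close> vertices arise only here and are therefore
  protected: a cop in the robber's copy threatens nobody there. The \<open>Decl\<close> vertices
  form a clique, so any declaration can follow any other, and a track cop that keeps its vertex
  (\<open>eq\<close>) may change its flag freely.\<close>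

definition link :: "tag \<Rightarrow> tag \<Rightarrow> nat \<Rightarrow> bool \<Rightarrow> bool \<Rightarrow> bool" where
  "link t t' c eq e = (case t of
     Cop s b \<Rightarrow> (case t' of Cop s' b' \<Rightarrow> c = 2 \<and> (eq \<or> e \<and> movable (s, b) (s', b')) | _ \<Rightarrow> False)
   | Decl _ \<Rightarrow> (case t' of Decl _ \<Rightarrow> True | _ \<Rightarrow> False)
   | Rob \<Rightarrow> t' = Rob \<and> e \<or> chk t'
   | _ \<Rightarrow> chk t \<and> (chk t' \<or> t' = Rob))"

lemma unprot_sym: "unprot t t' (cmp i j) ue = unprot t' t (cmp j i) ue"
  by (auto simp: unprot_def cmp_flip)

lemma link_sym: "link t t' (cmp i j) eq e = link t' t (cmp j i) eq e"
  by (cases t; cases t') (auto simp: link_def cmp_eq_2)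

section \<open>The new graph\<close>

locale reduction =
  fixes G :: "nat pgraph" and n K :: nat
  assumes wf: "wf_pgraph G" and V: "verts G = {..<n}" and K: "0 < K"
begin

lemma n_pos: "0 < n"
  using wf_verts_nonempty[OF wf] unfolding V by (cases n) simp_all

text \<open>A mixed radix numbering: the tag is the lowest digit, in base 16, then comes the
  original vertex in base \<open>n\<close>, then the track. The loops of the Turing machine are
  nested in the same order.\<close>

definition tag_of :: "nat \<Rightarrow> tag" where "tag_of x = tags ! (x mod 16)"
definition track :: "nat \<Rightarrow> nat" where "track x = x div 16 div n"
definition vertex :: "nat \<Rightarrow> nat" where "vertex x = x div 16 mod n"
definition N :: nat where "N = K * n * 16"

definition uadj :: "nat \<Rightarrow> nat \<Rightarrow> bool" where
  "uadj x y \<longleftrightarrow> unprot (tag_of x) (tag_of y) (cmp (track x) (track y)) ({vertex x, vertex y} \<in> edges G - protected_edges G)"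

definition ladj :: "nat \<Rightarrow> nat \<Rightarrow> bool" where
  "ladj x y \<longleftrightarrow> link (tag_of x) (tag_of y) (cmp (track x) (track y)) (vertex x = vertex y) ({vertex x, vertex y} \<in> edges G)"

definition graph :: "nat pgraph" where
  "graph = \<lparr>verts = {..<N},
     edges = {{x, y} | x y. x < N \<and> y < N \<and> (uadj x y \<or> ladj x y)},
     protected_edges = {{x, y} | x y. x < N \<and> y < N \<and> ladj x y \<and> \<not> uadj x y}\<rparr>"

lemma uadj_sym: "uadj x y = uadj y x"
  unfolding uadj_def by (subst unprot_sym) (simp only: insert_commute)

lemma ladj_sym: "ladj x y = ladj y x"
  unfolding ladj_def by (subst link_sym) (simp only: insert_commute eq_commute)

lemma in_edges: "{x, y} \<in> edges graph \<longleftrightarrow> x < N \<and> y < N \<and> (uadj x y \<or> ladj x y)"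
  using uadj_sym ladj_sym by (auto simp: graph_def doubleton_eq_iff)

lemma in_protected: "{x, y} \<in> protected_edges graph \<longleftrightarrow> x < N \<and> y < N \<and> ladj x y \<and> \<not> uadj x y"
  using uadj_sym ladj_sym by (auto simp: graph_def doubleton_eq_iff)

lemma in_unprotected:
  "{x, y} \<in> edges graph - protected_edges graph \<longleftrightarrow> x < N \<and> y < N \<and> uadj x y"
  by (auto simp: in_edges in_protected)

lemma vertex_less: "vertex x < n"
  using n_pos by (simp add: vertex_def)

lemma track_less: "x < N \<Longrightarrow> track x < K"
  using n_pos by (auto simp: track_def N_def less_mult_imp_div_less mult.commute mult.left_commute)

lemma loop_G: "{vertex x} \<in> edges G"
  using wf_loop[OF wf] vertex_less V by simp

lemma loop: "uadj x x \<or> ladj x x"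
  using loop_G[of x]
  by (cases "tag_of x") (auto simp: uadj_def ladj_def unprot_def threat_def link_def cmp_eq_2)

lemma verts_graph: "verts graph = {..<N}"
  by (simp add: graph_def)

lemma N_pos: "0 < N"
  using K n_pos by (simp add: N_def)

lemma wf_graph: "wf_pgraph graph"
proof -
  have "edges graph \<subseteq> {{u, v} | u v. u \<in> verts graph \<and> v \<in> verts graph}"
    "protected_edges graph \<subseteq> edges graph"
    unfolding graph_def by auto
  moreover have "\<forall>v \<in> verts graph. {v} \<in> edges graph"
  proof
    fix v assume "v \<in> verts graph"
    then have "{v, v} \<in> edges graph" using loop[of v] by (simp only: in_edges verts_graph lessThan_iff)
    then show "{v} \<in> edges graph" by simp
  qed
  moreover have "verts graph \<noteq> {}" "finite (verts graph)"
    using N_pos by (auto simp: verts_graph)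
  ultimately show ?thesis unfolding wf_pgraph_def by blast
qed

definition vx :: "tag \<Rightarrow> nat \<Rightarrow> nat \<Rightarrow> nat" where
  "vx t i u = (i * n + u) * 16 + (SOME m. m < 16 \<and> tags ! m = t)"

lemma vx:
  assumes "i < K" "u < n"
  shows "tag_of (vx t i u) = t" "track (vx t i u) = i" "vertex (vx t i u) = u" "vx t i u < N"
proof -
  define m where "m = (SOME m. m < 16 \<and> tags ! m = t)"
  have "\<exists>m. m < 16 \<and> tags ! m = t"
    using in_set_tags[of t] by (auto simp: in_set_conv_nth length_tags)
  then have m: "m < 16" "tags ! m = t" unfolding m_def by (metis (mono_tags, lifting) someI_ex)+
  have x: "vx t i u = (i * n + u) * 16 + m" by (simp add: vx_def m_def)
  have d: "vx t i u div 16 = i * n + u" "vx t i u mod 16 = m"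
    unfolding x using m(1) by (simp_all only: div_mult_self3 mod_mult_self3 div_less mod_less, simp_all?)
  show "tag_of (vx t i u) = t" "track (vx t i u) = i" "vertex (vx t i u) = u"
    using m assms by (simp_all add: tag_of_def track_def vertex_def d)
  have "Suc i * n \<le> K * n" using assms by (intro mult_le_mono1) simp
  then have "i * n + u < K * n" using assms by simp
  then show "vx t i u < N" using m(1) by (simp add: x N_def)
qed

section \<open>Translating a lazy win of the cops to the new graph\<close>

definition place :: "nat \<Rightarrow> bool \<Rightarrow> nat list \<Rightarrow> nat list" where
  "place j b C = map (\<lambda>i. vx (case_prod Cop (required (cmp i j) b)) i (C ! i)) [0..<K] @
     [vx (Decl b) j 0, vx Home 0 0]"

lemma place_nth:
  "i < K \<Longrightarrow> place j b C ! i = vx (case_prod Cop (required (cmp i j) b)) i (C ! i)"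
  "place j b C ! K = vx (Decl b) j 0" "place j b C ! Suc K = vx Home 0 0"
  "length (place j b C) = K + 2"
  by (simp_all add: place_def nth_append)

lemma nth_less: "length C = K \<Longrightarrow> set C \<subseteq> {..<n} \<Longrightarrow> i < K \<Longrightarrow> C ! i < n"
  by (metis lessThan_iff nth_mem subsetD)

lemma set_place:
  assumes "length C = K" "set C \<subseteq> {..<n}" "j < K"
  shows "set (place j b C) \<subseteq> {..<N}"
  using vx(4) nth_less[OF assms(1,2)] assms(3) K n_pos by (auto simp: place_def)

text \<open>A check for the prescribed flag is threatened by the cop of its track, a check for any
  other flag by the declaring cop. The bound \<open>m \<le> K\<close> leaves out the home cop, so
  these threats persist after it has gone to the hub.\<close>

lemma place_threatens_chk:
  assumes C: "length C = K" "set C \<subseteq> {..<n}" "j < K" and x: "x < N" "chk (tag_of x)" "tag_of x \<noteq> HomeChk"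
  shows "\<exists>m \<le> K. uadj (place j b C ! m) x"
proof -
  let ?i = "track x"
  have i: "?i < K" "C ! ?i < n" using track_less[OF x(1)] nth_less[OF C(1,2)] by auto
  note v = place_nth(1)[OF i(1), of j b C] vx(1-3)[OF i]
  note w = place_nth(2)[of j b C] vx(1-3)[OF C(3) n_pos]
  consider (tr) "tag_of x = TrackChk" | (decl) "tag_of x = DeclChk" | (flag) s b' where "tag_of x = Chk s b'"
    using x(2,3) by (cases "tag_of x") auto
  then show ?thesis
  proof cases
    case tr
    then have "uadj (place j b C ! ?i) x"
      by (simp add: v uadj_def unprot_def threat_def cmp_eq_2 split: prod.splits)
    then show ?thesis using i by (intro exI[of _ ?i]) simp
  next
    case decl
    then have "uadj (place j b C ! K) x"
      by (simp add: w uadj_def unprot_def threat_def)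
    then show ?thesis by blast
  next
    case flag
    show ?thesis
    proof (cases "required (cmp ?i j) b = (s, b')")
      case True
      then have "uadj (place j b C ! ?i) x"
        using flag by (simp add: v uadj_def unprot_def threat_def cmp_eq_2)
      then show ?thesis using i by (intro exI[of _ ?i]) simp
    next
      case False
      then have "uadj (place j b C ! K) x"
        using flag by (simp add: w uadj_def unprot_def threat_def cmp_flip)
      then show ?thesis by blast
    qed
  qed
qed

lemma forced_if_uadj:
  assumes "set D \<subseteq> {..<N}" "m < length D" "uadj (D ! m) x" "x < N"
  shows "forced (cop_move graph) graph D x"
proof -
  have "D ! m < N" using assms by (metis lessThan_iff nth_mem subsetD)
  then have e: "{D ! m, x} \<in> edges graph - protected_edges graph"
    using assms by (simp only: in_unprotected)
  then have "cop_move graph D (D[m := x])"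
    using assms by (intro cop_move_update[OF wf_graph]) (auto simp: verts_graph)
  then show ?thesis using e assms(2) by (intro forced_if_threatened)
qed

lemma forced_outside:
  assumes C: "length C = K" "set C \<subseteq> {..<n}" "j < K" and x: "x < N" "tag_of x \<noteq> Rob"
  shows "forced (cop_move graph) graph (place j b C) x"
proof -
  let ?P = "place j b C"
  note S = set_place[OF C, of b]
  have home: "uadj (?P ! Suc K) y" if "tag_of y = Home \<or> tag_of y = Hub \<or> tag_of y = HomeChk" for y
    using that vx(1)[OF K n_pos, of Home] by (auto simp: place_nth uadj_def unprot_def threat_def)
  consider (c) "chk (tag_of x)" "tag_of x \<noteq> HomeChk" | (h) "tag_of x = Home \<or> tag_of x = Hub \<or> tag_of x = HomeChk"
    | (a) "(\<exists>s b. tag_of x = Cop s b) \<or> (\<exists>b. tag_of x = Decl b)"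
    using x(2) by (cases "tag_of x") auto
  then show ?thesis
  proof cases
    case c
    then obtain m where "m \<le> K" "uadj (?P ! m) x" using place_threatens_chk[OF C x(1)] by blast
    then show ?thesis using x(1) by (intro forced_if_uadj[OF S, of m]) (simp_all add: place_nth)
  next
    case h
    then show ?thesis using x(1) home
      by (intro forced_if_uadj[OF S, of "Suc K"]) (simp_all add: place_nth)
  next
    case a
    \<comment> \<open>The hub is chosen over the original vertex of \<open>x\<close>: a robber who
      escapes from a track vertex over \<open>u\<close> into his copy uses an unprotected edge at
      \<open>u\<close>, and along those edges the hub over \<open>u\<close> threatens him as
      well.\<close>
    let ?h = "vx Hub 0 (vertex x)"
    let ?P' = "?P[Suc K := ?h]"
    have h: "?h < N" "tag_of ?h = Hub" "vertex ?h = vertex x" using vx[OF K vertex_less] by simp_all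
    have e: "{?P ! Suc K, ?h} \<in> edges graph"
      using home[of ?h] h vx(4)[OF K n_pos, of Home] by (simp add: in_edges place_nth)
    have mv: "cop_move graph ?P ?P'"
      using S e by (intro cop_move_update[OF wf_graph]) (simp_all add: verts_graph place_nth)
    have S': "set ?P' \<subseteq> {..<N}"
      using set_update_subset_insert[of ?P "Suc K" ?h] S h by auto
    have "forced (cop_move graph) graph ?P' y" if y: "{x, y} \<in> edges graph" for y
    proof -
      have yN: "y < N" and adj: "uadj x y \<or> ladj x y" using y by (simp_all add: in_edges)
      show ?thesis
      proof (cases "chk (tag_of y)")
        case True
        \<comment> \<open>\<open>HomeChk\<close> is the one kind of check that the departed home cop
          leaves unguarded, and no edge leads there from a track or a declaring vertex.\<close>
        then have "tag_of y \<noteq> HomeChk"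
          using a adj by (auto simp: uadj_def ladj_def unprot_def threat_def link_def)
        then obtain m where m: "m \<le> K" "uadj (?P ! m) y"
          using place_threatens_chk[OF C yN True] by blast
        then show ?thesis
          using yN by (intro forced_if_uadj[OF S', of m]) (simp_all add: place_nth)
      next
        case False
        then have "tag_of y \<noteq> Home"
          using a adj by (auto simp: uadj_def ladj_def unprot_def threat_def link_def)
        moreover have "uadj ?h y" if "tag_of y = Rob"
          using that a adj h(2,3) by (auto simp: uadj_def ladj_def unprot_def threat_def link_def)
        ultimately have "uadj ?h y"
          using False h(2) by (cases "tag_of y") (simp_all add: uadj_def unprot_def threat_def)
        then show ?thesis
          using yN by (intro forced_if_uadj[OF S', of "Suc K"]) (simp_all add: place_nth)
      qed
    qed
    with mv show ?thesis by (rule forced.advance)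
  qed
qed

lemma place_move:
  assumes C: "length C = K" "set C \<subseteq> {..<n}" "j < K" and mv: "lazy_cop_move G C C'"
  shows "\<exists>j' b'. j' < K \<and> cop_move graph (place j b C) (place j' b' C')"
proof -
  let ?D = "{i. i < length C \<and> C' ! i \<noteq> C ! i}"
  have cm: "cop_move G C C'" and card: "card ?D \<le> Suc 0" using mv by (simp_all add: lazy_cop_move_def)
  have C': "length C' = K" "set C' \<subseteq> {..<n}"
    using cop_move_verts[OF wf cm] C V by simp_all
  have "finite ?D" by simp
  with card have uniq: "\<forall>i \<in> ?D. \<forall>i' \<in> ?D. i = i'" by (simp only: card_le_Suc0_iff_eq)
  have "\<exists>i0<K. \<forall>i<K. i \<noteq> i0 \<longrightarrow> C' ! i = C ! i"
  proof (cases "?D = {}")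
    case True
    then show ?thesis using K C(1) by (intro exI[of _ 0]) simp
  next
    case False
    then obtain i where i: "i \<in> ?D" by blast
    have "C' ! i' = C ! i'" if "i' < K" "i' \<noteq> i" for i'
      using uniq[rule_format, OF i, of i'] that C(1) by auto
    then show ?thesis using i C(1) by (intro exI[of _ i]) simp
  qed
  then obtain i0 where i0: "i0 < K" "\<And>i. i < K \<Longrightarrow> i \<noteq> i0 \<Longrightarrow> C' ! i = C ! i"
    by blast
  \<comment> \<open>The next declaration names the track of the moving cop, with the parity that
    this track shows already; being marked afterwards with unchanged parity, the track is movable.
    All other track cops only change their flags in place.\<close>
  define b' where "b' = snd (required (cmp i0 j) b)"
  let ?P = "place j b C" and ?P' = "place i0 b' C'"
  have "{?P ! m, ?P' ! m} \<in> edges graph" if "m < K + 2" for m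
  proof -
    consider "m < K" | "m = K" | "m = Suc K" using \<open>m < K + 2\<close> by linarith
    then show ?thesis
    proof cases
      case 1
      have c: "C ! m < n" "C' ! m < n" using nth_less[OF C(1,2) 1] nth_less[OF C' 1] by auto
      note v = vx[OF 1 c(1)] and v' = vx[OF 1 c(2)]
      have "ladj (?P ! m) (?P' ! m)"
      proof (cases "m = i0")
        case False
        then show ?thesis
          using i0(2)[OF 1] by (simp add: place_nth 1 ladj_def v v' link_def cmp_eq_2 split: prod.splits)
      next
        case True
        have "{C ! m, C' ! m} \<in> edges G"
          using cm 1 C by (simp add: cop_move_def list_all2_conv_all_nth)
        moreover have "movable (required (cmp m j) b) (required (cmp m i0) b')"
          unfolding True by (simp add: required_def b'_def cmp_def)
        ultimately show ?thesis
          by (auto simp: place_nth 1 ladj_def v v' link_def cmp_eq_2 split: prod.splits)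
      qed
      then show ?thesis using v v' by (simp add: in_edges place_nth 1)
    next
      case 2
      then show ?thesis
        using vx[OF C(3) n_pos] vx[OF i0(1) n_pos] by (simp add: in_edges place_nth ladj_def link_def)
    next
      case 3
      then show ?thesis
        using vx(4)[OF K n_pos] wf_loop[OF wf_graph] by (simp add: verts_graph place_nth)
    qed
  qed
  then have "cop_move graph ?P ?P'"
    by (simp add: cop_move_def list_all2_conv_all_nth place_nth)
  then show ?thesis using i0(1) by blast
qed

text \<open>The declaration changes from round to round, and the robber may switch between the twins
  of a \<open>Rob\<close> vertex, so \<open>j\<close>, \<open>b\<close> and \<open>x\<close> are
  generalized in the induction. Whenever he leaves \<open>Rob\<close>, \<open>forced_outside\<close>
  takes over.\<close>

lemma lazy_forced_place:
  assumes "forced (lazy_cop_move G) G C r" "length C = K" "set C \<subseteq> {..<n}" "j < K"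
    "x < N" "tag_of x = Rob" "vertex x = r"
  shows "forced (cop_move graph) graph (place j b C) x"
  using assms
proof (induction arbitrary: j b x rule: forced.induct)
  case (capture C C' r)
  note C = capture.prems(1-3)
  obtain i where i: "i < K" "{C ! i, r} \<in> edges G - protected_edges G"
    using capture(2) C by (auto simp: captures_def)
  have c: "C ! i < n" using nth_less[OF C(1,2) i(1)] .
  have "uadj (place j b C ! i) x"
    using i capture.prems vx[OF i(1) c]
    by (simp add: place_nth uadj_def unprot_def threat_def split: prod.splits)
  then show ?case
    using i(1) capture.prems by (intro forced_if_uadj[OF set_place[OF C], of i]) (simp_all add: place_nth)
next
  case (advance C C' r)
  note C = advance.prems(1-3)
  obtain j' b' where mv: "j' < K" "cop_move graph (place j b C) (place j' b' C')"
    using place_move[OF C advance(1)] by blast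
  have C': "length C' = K" "set C' \<subseteq> {..<n}"
    using cop_move_verts[OF wf, of C C'] advance(1) C V by (simp_all add: lazy_cop_move_def)
  have "forced (cop_move graph) graph (place j' b' C') y" if y: "{x, y} \<in> edges graph" for y
  proof (cases "tag_of y = Rob")
    case True
    have yN: "y < N" and adj: "uadj x y \<or> ladj x y" using y by (simp_all add: in_edges)
    then have "{r, vertex y} \<in> edges G"
      using True advance.prems by (auto simp: uadj_def ladj_def unprot_def threat_def link_def)
    from advance.IH[OF this C' mv(1) yN True refl] show ?thesis .
  next
    case False
    have "y < N" using y by (simp add: in_edges)
    then show ?thesis by (rule forced_outside[OF C' mv(1) _ False])
  qed
  with mv(2) show ?case by (rule forced.advance)
qed

lemma cops_win_graph:
  assumes "lazy_cops_win G K"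
  shows "cops_win graph (K + 2)"
proof -
  obtain C where C: "length C = K" "set C \<subseteq> {..<n}" "\<forall>r<n. forced (lazy_cop_move G) G C r"
    using assms V by (auto simp: lazy_cops_win_iff[OF wf])
  have "forced (cop_move graph) graph (place 0 False C) x" if x: "x < N" for x
  proof (cases "tag_of x = Rob")
    case True
    show ?thesis
      using C(3) vertex_less lazy_forced_place[OF _ C(1,2) K x True refl] by blast
  next
    case False
    then show ?thesis using forced_outside[OF C(1,2) K x] by blast
  qed
  then show ?thesis
    using set_place[OF C(1,2) K] unfolding cops_win_iff[OF wf_graph] verts_graph
    by (intro exI[of _ "place 0 False C"]) (simp add: place_nth)
qed

section \<open>Cop positions that threaten every check\<close>

definition all_covered :: "nat list \<Rightarrow> bool" where
  "all_covered D \<longleftrightarrow> length D = K + 2 \<and> set D \<subseteq> {..<N} \<and>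
     (\<forall>x<N. chk (tag_of x) \<longrightarrow> (\<exists>m<K + 2. uadj (D ! m) x))"

text \<open>The \<open>K + 2\<close> roles have to be filled by \<open>K + 2\<close> cops, so each is filled exactly once.\<close>

definition role :: "nat \<Rightarrow> nat" where
  "role x = (case tag_of x of Cop _ _ \<Rightarrow> track x | Decl _ \<Rightarrow> K | Home \<Rightarrow> K + 1 | _ \<Rightarrow> K + 2)"

definition cop_index :: "nat list \<Rightarrow> nat \<Rightarrow> nat" where
  "cop_index D i = (SOME m. m < K + 2 \<and> role (D ! m) = i)"

definition cop_vertices :: "nat list \<Rightarrow> nat list" where
  "cop_vertices D = map (\<lambda>i. vertex (D ! cop_index D i)) [0..<K]"

lemma all_covered_nth: "all_covered D \<Longrightarrow> m < K + 2 \<Longrightarrow> D ! m < N"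
  unfolding all_covered_def by (metis lessThan_iff nth_mem subsetD)

text \<open>\<open>TrackChk\<close>, \<open>DeclChk\<close> and \<open>HomeChk\<close> can be
  threatened only from the role that each tests for. Hence all \<open>K + 2\<close> roles occur, and
  counting makes the assignment of cops to roles bijective.\<close>

lemma all_covered_roles:
  assumes "all_covered D"
  shows "distinct (map role D)" "set (map role D) = {..<K + 2}"
proof -
  have len: "length (map role D) = K + 2" using assms by (simp add: all_covered_def)
  have cov: "\<exists>m<K + 2. uadj (D ! m) (vx t i 0)" if "chk t" "i < K" for t i
    using assms vx[OF that(2) n_pos] that(1) by (simp add: all_covered_def)
  have "r \<in> set (map role D)" if "r < K + 2" for r
  proof -
    have "\<exists>m<K + 2. role (D ! m) = r"
    proof -
      consider "r < K" | "r = K" | "r = K + 1" using \<open>r < K + 2\<close> by linarith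
      then show ?thesis
      proof cases
        case 1
        obtain m where m: "m < K + 2" "uadj (D ! m) (vx TrackChk r 0)" using cov[of TrackChk r] 1 by auto
        then have "role (D ! m) = r"
          using vx[OF 1 n_pos] by (cases "tag_of (D ! m)") (simp_all add: uadj_def unprot_def threat_def role_def cmp_eq_2)
        then show ?thesis using m by blast
      next
        case 2
        obtain m where m: "m < K + 2" "uadj (D ! m) (vx DeclChk 0 0)" using cov[of DeclChk 0] K by auto
        then have "role (D ! m) = r"
          using vx[OF K n_pos] 2 by (cases "tag_of (D ! m)") (simp_all add: uadj_def unprot_def threat_def role_def)
        then show ?thesis using m by blast
      next
        case 3
        obtain m where m: "m < K + 2" "uadj (D ! m) (vx HomeChk 0 0)" using cov[of HomeChk 0] K by auto
        then have "role (D ! m) = r"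
          using vx[OF K n_pos] 3 by (cases "tag_of (D ! m)") (simp_all add: uadj_def unprot_def threat_def role_def)
        then show ?thesis using m by blast
      qed
    qed
    then obtain m where "m < length (map role D)" "map role D ! m = r" using len by auto
    then show ?thesis by (metis nth_mem)
  qed
  then have sub: "{..<K + 2} \<subseteq> set (map role D)" by blast
  have le: "card (set (map role D)) \<le> K + 2" using card_length[of "map role D"] len by simp
  moreover have ge: "card {..<K + 2} \<le> card (set (map role D))"
    by (rule card_mono[OF finite_set sub])
  ultimately have c: "card (set (map role D)) = K + 2" by simp
  show "distinct (map role D)" using c len by (intro card_distinct) simp
  show "set (map role D) = {..<K + 2}"
    using card_subset_eq[OF finite_set sub] c by simp
qed

lemma all_covered_role_less:
  assumes "all_covered D" "m < K + 2"
  shows "role (D ! m) < K + 2"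
proof -
  have "map role D ! m \<in> set (map role D)"
    using assms by (intro nth_mem) (simp add: all_covered_def)
  then show ?thesis
    unfolding all_covered_roles(2)[OF assms(1)] using assms by (simp add: all_covered_def)
qed

lemma cop_index:
  assumes "all_covered D" "i < K + 2"
  shows "cop_index D i < K + 2" "role (D ! cop_index D i) = i"
proof -
  have "i \<in> set (map role D)" using all_covered_roles(2)[OF assms(1)] assms(2) by blast
  then obtain m where "m < length D" "role (D ! m) = i"
    unfolding in_set_conv_nth by auto
  then have "\<exists>m. m < K + 2 \<and> role (D ! m) = i" using assms(1) by (auto simp: all_covered_def)
  then have "cop_index D i < K + 2 \<and> role (D ! cop_index D i) = i" unfolding cop_index_def by (rule someI_ex)
  then show "cop_index D i < K + 2" "role (D ! cop_index D i) = i" by simp_all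
qed

lemma cop_index_unique:
  assumes "all_covered D" "m < K + 2"
  shows "cop_index D (role (D ! m)) = m"
proof -
  let ?i = "cop_index D (role (D ! m))"
  have i: "?i < K + 2" "role (D ! ?i) = role (D ! m)"
    using cop_index[OF assms(1) all_covered_role_less[OF assms]] by simp_all
  have "length D = K + 2" using assms(1) by (simp add: all_covered_def)
  then show ?thesis
    using nth_eq_iff_index_eq[OF all_covered_roles(1)[OF assms(1)], of ?i m] i assms(2) by simp
qed

lemma role_Decl: "x < N \<Longrightarrow> role x = K \<longleftrightarrow> (\<exists>b. tag_of x = Decl b)"
  using track_less[of x] by (cases "tag_of x") (simp_all add: role_def)

text \<open>On each track the check for the prescribed flag is spared by the declaring cop, and
  there is no second one. So it must be threatened from its own track, by a cop that shows exactly
  this flag.\<close>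

lemma all_covered_flags:
  assumes "all_covered D"
  obtains j b where
    "\<And>i. i < K \<Longrightarrow> tag_of (D ! cop_index D i) = case_prod Cop (required (cmp i j) b)"
proof -
  let ?d = "D ! cop_index D K"
  have d: "cop_index D K < K + 2" "role ?d = K" using cop_index[OF assms, of K] by simp_all
  then obtain b where b: "tag_of ?d = Decl b"
    using role_Decl[OF all_covered_nth[OF assms]] by blast
  have "tag_of (D ! cop_index D i) = case_prod Cop (required (cmp i (track ?d)) b)" if i: "i < K" for i
  proof -
    obtain s b' where r: "required (cmp i (track ?d)) b = (s, b')" by fastforce
    let ?x = "vx (Chk s b') i 0"
    note x = vx[OF i n_pos, of "Chk s b'"]
    obtain m where m: "m < K + 2" "uadj (D ! m) ?x"
      using assms x by (auto simp: all_covered_def)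
    have nd: "\<not> uadj ?d ?x"
      using b r x by (simp add: uadj_def unprot_def threat_def cmp_flip)
    have "role (D ! m) \<noteq> K"
      using cop_index_unique[OF assms m(1)] nd m(2) by auto
    then have "tag_of (D ! m) = Cop s b' \<and> track (D ! m) = i"
      using m(2) x by (cases "tag_of (D ! m)") (simp_all add: uadj_def unprot_def threat_def role_def cmp_eq_2)
    moreover from this have "cop_index D i = m"
      using cop_index_unique[OF assms m(1)] by (simp add: role_def)
    ultimately show ?thesis using r by simp
  qed
  then show thesis by (rule that)
qed

text \<open>A cop that changes its role has to pass through a vertex without a role, such as the
  hub; in the meantime some check is not threatened.\<close>

lemma role_adjacent:
  assumes "uadj x y \<or> ladj x y" "role x < K + 2" "role y < K + 2"
  shows "role x = role y"
  using assms
  by (cases "tag_of x"; cases "tag_of y")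
    (simp_all add: uadj_def ladj_def unprot_def threat_def link_def role_def cmp_eq_2)

lemma cop_index_cong:
  assumes "all_covered D" "all_covered D'" "cop_move graph D D'"
  shows "cop_index D = cop_index D'"
proof -
  have "role (D ! m) = role (D' ! m)" if m: "m < K + 2" for m
  proof -
    have "{D ! m, D' ! m} \<in> edges graph"
      using assms(1,3) m by (simp add: cop_move_def list_all2_conv_all_nth all_covered_def)
    then have "uadj (D ! m) (D' ! m) \<or> ladj (D ! m) (D' ! m)" by (simp add: in_edges)
    then show ?thesis
      using all_covered_role_less[OF assms(1) m] all_covered_role_less[OF assms(2) m] by (rule role_adjacent)
  qed
  then have "(\<lambda>m. m < K + 2 \<and> role (D ! m) = i) = (\<lambda>m. m < K + 2 \<and> role (D' ! m) = i)" for i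
    by fastforce
  then show ?thesis unfolding cop_index_def by simp
qed

lemma cop_vertices_nth: "i < K \<Longrightarrow> cop_vertices D ! i = vertex (D ! cop_index D i)" "length (cop_vertices D) = K"
  by (simp_all add: cop_vertices_def)

lemma set_cop_vertices: "set (cop_vertices D) \<subseteq> verts G"
  using vertex_less by (auto simp: cop_vertices_def V)

text \<open>Both positions show prescribed flags, and each cop keeps its role. An edge within a
  track that changes the original vertex requires \<open>movable\<close>, which holds for at most
  one track.\<close>

lemma cop_vertices_move:
  assumes "all_covered D" "all_covered D'" "cop_move graph D D'"
  shows "lazy_cop_move G (cop_vertices D) (cop_vertices D')"
proof -
  obtain j b where f: "\<And>i. i < K \<Longrightarrow> tag_of (D ! cop_index D i) = case_prod Cop (required (cmp i j) b)"
    using all_covered_flags[OF assms(1)] by blast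
  obtain j' b' where f': "\<And>i. i < K \<Longrightarrow> tag_of (D' ! cop_index D' i) = case_prod Cop (required (cmp i j') b')"
    using all_covered_flags[OF assms(2)] by blast
  note ix_eq = cop_index_cong[OF assms]
  have step: "cop_vertices D' ! i = cop_vertices D ! i \<or> {cop_vertices D ! i, cop_vertices D' ! i} \<in> edges G \<and>
      movable (required (cmp i j) b) (required (cmp i j') b')" if i: "i < K" for i
  proof -
    let ?x = "D ! cop_index D i" and ?y = "D' ! cop_index D' i"
    have "cop_index D i < K + 2" using cop_index[OF assms(1)] i by simp
    then have "{?x, ?y} \<in> edges graph"
      using assms(1,3) by (simp add: cop_move_def list_all2_conv_all_nth all_covered_def ix_eq)
    then have "uadj ?x ?y \<or> ladj ?x ?y" by (simp add: in_edges)
    then show ?thesis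
      using f[OF i] f'[OF i] by (auto simp: uadj_def ladj_def unprot_def threat_def link_def cop_vertices_nth i split: prod.splits)
  qed
  have "{cop_vertices D ! i, cop_vertices D' ! i} \<in> edges G" if i: "i < K" for i
  proof (cases "cop_vertices D' ! i = cop_vertices D ! i")
    case True
    then show ?thesis using loop_G by (simp add: cop_vertices_nth i)
  next
    case False
    then show ?thesis using step[OF i] by blast
  qed
  then have "cop_move G (cop_vertices D) (cop_vertices D')"
    by (simp add: cop_move_def list_all2_conv_all_nth cop_vertices_nth(2))
  moreover have "card {i. i < length (cop_vertices D) \<and> cop_vertices D' ! i \<noteq> cop_vertices D ! i} \<le> Suc 0"
  proof (subst card_le_Suc0_iff_eq)
    show "\<forall>i \<in> {i. i < length (cop_vertices D) \<and> cop_vertices D' ! i \<noteq> cop_vertices D ! i}.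
        \<forall>i' \<in> {i. i < length (cop_vertices D) \<and> cop_vertices D' ! i \<noteq> cop_vertices D ! i}. i = i'"
    proof (intro ballI)
      fix i i'
      assume "i \<in> {i. i < length (cop_vertices D) \<and> cop_vertices D' ! i \<noteq> cop_vertices D ! i}"
        and "i' \<in> {i. i < length (cop_vertices D) \<and> cop_vertices D' ! i \<noteq> cop_vertices D ! i}"
      then have "movable (required (cmp i j) b) (required (cmp i j') b')"
        "movable (required (cmp i' j) b) (required (cmp i' j') b')"
        using step[of i] step[of i'] by (simp_all add: cop_vertices_nth(2))
      then show "i = i'" by (rule movable_unique)
    qed
  qed simp
  ultimately show ?thesis by (simp add: lazy_cop_move_def)
qed

section \<open>The robber's strategy on the new graph\<close>

definition robber_safe :: "nat list \<Rightarrow> nat \<Rightarrow> bool" where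
  "robber_safe D x \<longleftrightarrow> x < N \<and> length D = K + 2 \<and> set D \<subseteq> {..<N} \<and>
     (chk (tag_of x) \<and> (\<forall>m<K + 2. \<not> uadj (D ! m) x) \<or>
      all_covered D \<and> tag_of x = Rob \<and> \<not> forced (lazy_cop_move G) G (cop_vertices D) (vertex x))"

text \<open>Every cop position leaves a safe vertex. Either some check is free, or the cops are in
  order and \<open>cop_vertices D\<close> is an initial placement of the lazy game, against which
  the robber has a starting vertex that is not forced.\<close>

lemma robber_safe_start:
  assumes "\<not> lazy_cops_win G K" "length D = K + 2" "set D \<subseteq> {..<N}"
  shows "\<exists>x. robber_safe D x"
proof (cases "all_covered D")
  case False
  then show ?thesis using assms(2,3) unfolding robber_safe_def all_covered_def by blast
next
  case True
  have "\<not> (\<forall>r \<in> verts G. forced (lazy_cop_move G) G (cop_vertices D) r)"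
    using assms(1) set_cop_vertices cop_vertices_nth(2) unfolding lazy_cops_win_iff[OF wf] by blast
  then obtain v where v: "v < n" "\<not> forced (lazy_cop_move G) G (cop_vertices D) v" using V by auto
  then have "robber_safe D (vx Rob 0 v)"
    using True assms vx[OF K v(1)] by (simp add: robber_safe_def)
  then show ?thesis ..
qed

text \<open>Only track cops and hub cops threaten \<open>Rob\<close> vertices. With all checks
  covered nobody is on a hub, and a capture by a track cop would be a capture by a single cop in the
  lazy game.\<close>

lemma robber_safe_not_captured:
  assumes "robber_safe D x"
  shows "\<not> captures graph D D' x"
proof
  assume "captures graph D D' x"
  then obtain m where m: "m < K + 2" "{D ! m, x} \<in> edges graph - protected_edges graph"
    using assms by (auto simp: captures_def robber_safe_def)
  then have uadj: "uadj (D ! m) x" by (simp only: in_unprotected)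
  then have g: "all_covered D" "tag_of x = Rob" "\<not> forced (lazy_cop_move G) G (cop_vertices D) (vertex x)"
    using assms m(1) by (auto simp: robber_safe_def)
  let ?i = "track (D ! m)"
  obtain s b where t: "tag_of (D ! m) = Cop s b" and e: "{vertex (D ! m), vertex x} \<in> edges G - protected_edges G"
    using uadj g(2) all_covered_role_less[OF g(1) m(1)]
    by (cases "tag_of (D ! m)") (simp_all add: uadj_def unprot_def threat_def role_def)
  have i: "?i < K" using track_less all_covered_nth[OF g(1) m(1)] by simp
  have "cop_index D ?i = m" using cop_index_unique[OF g(1) m(1)] t by (simp add: role_def)
  then have e': "{cop_vertices D ! ?i, vertex x} \<in> edges G - protected_edges G"
    using e i by (simp add: cop_vertices_nth)
  then have "lazy_cop_move G (cop_vertices D) ((cop_vertices D)[?i := vertex x])"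
    using i by (intro lazy_cop_move_update[OF wf set_cop_vertices]) (simp_all add: cop_vertices_nth(2))
  then have "forced (lazy_cop_move G) G (cop_vertices D) (vertex x)"
    using e' i by (intro forced_if_threatened[where i = ?i]) (simp_all add: cop_vertices_nth(2))
  then show False using g(3) by simp
qed

lemma robber_safe_step:
  assumes nwin: "\<not> lazy_cops_win G K" and safe: "robber_safe D x" and mv: "cop_move graph D D'"
  shows "\<exists>y. {x, y} \<in> edges graph \<and> robber_safe D' y"
proof -
  have D': "length D' = K + 2" "set D' \<subseteq> {..<N}"
    using cop_move_verts[OF wf_graph mv] safe by (simp_all add: robber_safe_def verts_graph)
  have x: "x < N" "chk (tag_of x) \<or> tag_of x = Rob" using safe by (auto simp: robber_safe_def)
  show ?thesis
  proof (cases "all_covered D' \<and> tag_of x = Rob")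
    case True
    then have g: "all_covered D" "\<not> forced (lazy_cop_move G) G (cop_vertices D) (vertex x)"
      using safe by (auto simp: robber_safe_def)
    have "lazy_cop_move G (cop_vertices D) (cop_vertices D')"
      using cop_vertices_move[OF g(1) _ mv] True by simp
    then obtain v where v: "{vertex x, v} \<in> edges G" "\<not> forced (lazy_cop_move G) G (cop_vertices D') v"
      using g(2) forced.advance[of "lazy_cop_move G" "cop_vertices D" "cop_vertices D'"] by blast
    have vn: "v < n" using wf_edge_verts[OF wf v(1)] V by simp
    let ?y = "vx Rob 0 v"
    note y = vx[OF K vn]
    have "robber_safe D' ?y" using v(2) True D' y by (simp add: robber_safe_def)
    moreover have "{x, ?y} \<in> edges graph"
      using x(1) True v(1) y by (simp add: in_edges ladj_def link_def)
    ultimately show ?thesis by blast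
  next
    case False
    \<comment> \<open>The target can be taken from the start of a fresh game: a check is adjacent to
      all checks and all \<open>Rob\<close> vertices, and a robber on \<open>Rob\<close> is in this
      case only because \<open>D'\<close> leaves a check free, so that his target is a
      check.\<close>
    obtain y where y: "robber_safe D' y" using robber_safe_start[OF nwin D'] by blast
    then have "chk (tag_of x) \<and> (chk (tag_of y) \<or> tag_of y = Rob) \<or> tag_of x = Rob \<and> chk (tag_of y)"
      using False x(2) by (auto simp: robber_safe_def)
    then have "ladj x y" by (cases "tag_of x") (auto simp: ladj_def link_def)
    moreover have "y < N" using y by (simp add: robber_safe_def)
    ultimately show ?thesis using x(1) y by (intro exI[of _ y]) (simp add: in_edges)
  qed
qed

lemma lazy_cops_win_if_cops_win_graph:
  assumes "cops_win graph (K + 2)"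
  shows "lazy_cops_win G K"
proof (rule ccontr)
  assume nwin: "\<not> lazy_cops_win G K"
  obtain D where D: "length D = K + 2" "set D \<subseteq> {..<N}" "\<forall>x<N. forced (cop_move graph) graph D x"
    using assms by (auto simp: cops_win_iff[OF wf_graph] verts_graph)
  have "\<not> robber_safe D x" if "forced (cop_move graph) graph D x" for D x
    using that
  proof (induction rule: forced.induct)
    case (capture D D' x)
    then show ?case using robber_safe_not_captured by blast
  next
    case (advance D D' x)
    then show ?case using robber_safe_step[OF nwin _ advance(1)] by blast
  qed
  moreover obtain x where x: "robber_safe D x" using robber_safe_start[OF nwin D(1,2)] by blast
  moreover from x have "x < N" by (simp add: robber_safe_def)
  ultimately show False using D(3) by blast
qed

lemma not_cops_win_graph:
  assumes v: "v < n" and prot: "\<And>u. {u, v} \<notin> edges G - protected_edges G"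
  shows "\<not> cops_win graph m"
proof (rule not_cops_win_if_protected(1)[OF wf_graph])
  note y = vx[OF K v, of Rob]
  show "vx Rob 0 v \<in> verts graph" using y by (simp add: verts_graph)
  fix x
  show "{x, vx Rob 0 v} \<notin> edges graph - protected_edges graph"
  proof
    assume "{x, vx Rob 0 v} \<in> edges graph - protected_edges graph"
    then have "uadj x (vx Rob 0 v)" by (simp only: in_unprotected)
    then have "{vertex x, v} \<in> edges G - protected_edges G"
      using y by (cases "tag_of x") (simp_all add: uadj_def unprot_def threat_def)
    then show False using prot by blast
  qed
qed

text \<open>The new instance has \<open>k + 2\<close> cops even when only \<open>n\<close> tracks
  exist. For \<open>k > n\<close> the surplus cops do no harm in one direction; in the other, a lazy
  loss means a vertex without unprotected edges, whose \<open>Rob\<close> copy is safe from any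
  number of cops.\<close>

lemma lazy_cops_win_iff_cops_win_graph:
  assumes k: "K = min k n"
  shows "lazy_cops_win G k \<longleftrightarrow> cops_win graph (k + 2)"
proof (cases "k \<le> n")
  case True
  then show ?thesis
    using cops_win_graph lazy_cops_win_if_cops_win_graph k by auto
next
  case False
  then have Kn: "K = n" "n \<le> k" using k by simp_all
  show ?thesis
  proof
    assume "lazy_cops_win G k"
    then have "lazy_cops_win G n"
      using lazy_cops_win_many[OF wf V] Kn(2) by simp
    then have "cops_win graph (K + 2)" using cops_win_graph Kn(1) by simp
    then show "cops_win graph (k + 2)"
      by (rule cops_win_mono[OF wf_graph]) (use Kn in simp)
  next
    assume win: "cops_win graph (k + 2)"
    show "lazy_cops_win G k"
    proof (rule ccontr)
      assume "\<not> lazy_cops_win G k"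
      then obtain v where "v < n" "\<And>u. {u, v} \<notin> edges G - protected_edges G"
        using lazy_cops_win_many[OF wf V Kn(2)] by blast
      then show False using not_cops_win_graph win by blast
    qed
  qed
qed

end

section \<open>Structured programs for Turing machines\<close>

datatype com =
    Write nat "nat list \<Rightarrow> nat" dir
  | Seq com com  (infixr ";;" 60)
  | Cond "nat list \<Rightarrow> bool" com com
  | While "nat list \<Rightarrow> bool" com

abbreviation scan :: "tape list \<Rightarrow> nat list" where
  "scan ts \<equiv> map (\<lambda>(h, c). c h) ts"

inductive exec :: "com \<Rightarrow> tape list \<Rightarrow> nat \<Rightarrow> tape list \<Rightarrow> bool" where
  Write: "m < length ts \<Longrightarrow> exec (Write m g d) ts 1 (ts[m := act (g (scan ts), d) (ts ! m)])"
| Seq: "exec a ts t ts' \<Longrightarrow> exec b ts' t' ts'' \<Longrightarrow> exec (a ;; b) ts (t + t') ts''"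
| CondT: "P (scan ts) \<Longrightarrow> exec a ts t ts' \<Longrightarrow> exec (Cond P a b) ts (Suc t) ts'"
| CondF: "\<not> P (scan ts) \<Longrightarrow> exec b ts t ts' \<Longrightarrow> exec (Cond P a b) ts (Suc t) ts'"
| WhileF: "\<not> P (scan ts) \<Longrightarrow> exec (While P a) ts 1 ts"
| WhileT: "P (scan ts) \<Longrightarrow> exec a ts t ts' \<Longrightarrow> exec (While P a) ts' t' ts'' \<Longrightarrow>
    exec (While P a) ts (Suc (t + t')) ts''"

fun csize :: "com \<Rightarrow> nat" where
  "csize (Write m g d) = 1"
| "csize (a ;; b) = csize a + csize b"
| "csize (Cond P a b) = Suc (csize a + csize b)"
| "csize (While P a) = Suc (csize a)"

abbreviation idle :: "nat list \<Rightarrow> (nat \<times> dir) list" where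
  "idle ss \<equiv> map (\<lambda>s. (s, Stay)) ss"

text \<open>The states of the code of a command at \<open>p\<close> are \<open>p, \<dots>, p + csize c - 1\<close>; it leaves to \<open>e\<close>.\<close>

fun code :: "com \<Rightarrow> nat \<Rightarrow> nat \<Rightarrow> nat \<Rightarrow> nat list \<Rightarrow> nat \<times> (nat \<times> dir) list" where
  "code (Write m g d) p e q ss = (e, (idle ss)[m := (g ss, d)])"
| "code (a ;; b) p e q ss =
     (if q < p + csize a then code a p (p + csize a) q ss else code b (p + csize a) e q ss)"
| "code (Cond P a b) p e q ss =
     (if q = p then (if P ss then Suc p else Suc (p + csize a), idle ss)
      else if q < Suc (p + csize a) then code a (Suc p) e q ss
      else code b (Suc (p + csize a)) e q ss)"
| "code (While P a) p e q ss =
     (if q = p then (if P ss then Suc p else e, idle ss) else code a (Suc p) p q ss)"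

definition tm_of :: "nat \<Rightarrow> nat \<Rightarrow> com \<Rightarrow> tm" where
  "tm_of n s c = \<lparr>tapes = n, symbols = s, states = csize c, trans = code c 0 (csize c)\<rparr>"

fun wf_com :: "nat \<Rightarrow> nat \<Rightarrow> com \<Rightarrow> bool" where
  "wf_com n s (Write m g d) \<longleftrightarrow>
     m < n \<and> (\<forall>ss. length ss = n \<and> set ss \<subseteq> {..<s} \<longrightarrow> g ss < s)"
| "wf_com n s (a ;; b) \<longleftrightarrow> wf_com n s a \<and> wf_com n s b"
| "wf_com n s (Cond P a b) \<longleftrightarrow> wf_com n s a \<and> wf_com n s b"
| "wf_com n s (While P a) \<longleftrightarrow> wf_com n s a"

lemma map2_act_idle: "map2 act (idle (scan ts)) ts = ts"
  by (induction ts) auto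

lemma map2_act_update:
  "m < length ts \<Longrightarrow> map2 act ((idle (scan ts))[m := x]) ts = ts[m := act x (ts ! m)]"
proof (induction ts arbitrary: m)
  case (Cons a ts)
  then show ?case
    by (cases a; cases m) (auto simp: map2_act_idle simp del: map_map)
qed simp

text \<open>The code sits at \<open>p\<close> in an arbitrary machine with an arbitrary exit
  \<open>e\<close>, because the induction passes to subcommands at shifted positions that exit to
  the next command or back to a loop head. The bound on \<open>states M\<close> keeps
  \<open>M\<close> from halting inside the code.\<close>

lemma exec_steps:
  assumes "exec c ts t ts'"
    and "\<And>q ss. p \<le> q \<Longrightarrow> q < p + csize c \<Longrightarrow> trans M q ss = code c p e q ss"
    and "p + csize c \<le> states M"
  shows "(step M ^^ t) (p, ts) = (e, ts')"
  using assms
proof (induction arbitrary: p e rule: exec.induct)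
  case (Write m ts g d)
  then show ?case by (simp add: map2_act_update del: map_map)
next
  case (Seq a ts t ts' b t' ts'')
  have "(step M ^^ t) (p, ts) = (p + csize a, ts')"
    using Seq.prems by (intro Seq.IH(1)) auto
  moreover have "(step M ^^ t') (p + csize a, ts') = (e, ts'')"
    using Seq.prems by (intro Seq.IH(2)) auto
  moreover have "step M ^^ (t + t') = (step M ^^ t') \<circ> (step M ^^ t)"
    by (metis add.commute funpow_add)
  ultimately show ?case by simp
next
  case (CondT P ts a t ts' b)
  have "(step M ^^ t) (Suc p, ts) = (e, ts')"
    using CondT.prems by (intro CondT.IH) auto
  moreover have "step M (p, ts) = (Suc p, ts)"
    using CondT.prems CondT.hyps by (simp add: map2_act_idle del: map_map)
  ultimately show ?case by (simp add: funpow_swap1)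
next
  case (CondF P ts b t ts' a)
  have "(step M ^^ t) (Suc (p + csize a), ts) = (e, ts')"
    using CondF.prems by (intro CondF.IH) auto
  moreover have "step M (p, ts) = (Suc (p + csize a), ts)"
    using CondF.prems CondF.hyps by (simp add: map2_act_idle del: map_map)
  ultimately show ?case by (simp add: funpow_swap1)
next
  case (WhileF P ts a)
  then show ?case by (simp add: map2_act_idle del: map_map)
next
  case (WhileT P ts a t ts' t' ts'')
  have "(step M ^^ t) (Suc p, ts) = (p, ts')"
    using WhileT.prems by (intro WhileT.IH(1)) auto
  moreover have "step M (p, ts) = (Suc p, ts)"
    using WhileT.prems WhileT.hyps by (simp add: map2_act_idle del: map_map)
  moreover have "(step M ^^ t') (p, ts') = (e, ts'')"
    using WhileT.prems by (intro WhileT.IH(2)) auto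
  moreover have "step M ^^ (Suc (t + t')) = (step M ^^ t') \<circ> (step M ^^ t) \<circ> step M"
    by (metis add.commute funpow_Suc_right funpow_add)
  ultimately show ?case by (simp del: step.simps)
qed

lemma fst_code_le:
  "p + csize c \<le> N \<Longrightarrow> e \<le> N \<Longrightarrow> fst (code c p e q ss) \<le> N"
  by (induction c arbitrary: p e) auto

lemma snd_code:
  "wf_com n s c \<Longrightarrow> length ss = n \<Longrightarrow> set ss \<subseteq> {..<s} \<Longrightarrow>
   length (snd (code c p e q ss)) = n \<and> fst ` set (snd (code c p e q ss)) \<subseteq> {..<s}"
proof (induction c arbitrary: p e)
  case (Write m g d)
  then have "fst ` set ((idle ss)[m := (g ss, d)]) \<subseteq> fst ` insert (g ss, d) (set (idle ss))"
    by (intro image_mono set_update_subset_insert)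
  also have "\<dots> \<subseteq> {..<s}"
    using Write by auto
  finally show ?case using Write by simp
qed auto

lemma wf_tm_of:
  assumes "wf_com n s c" "2 \<le> n" "3 \<le> s"
  shows "wf_tm (tm_of n s c)"
  using assms snd_code[OF assms(1)] fst_code_le[of 0 c "csize c" "csize c"]
  by (simp add: wf_tm_def tm_of_def)

text \<open>An upper bound instead of the exact time lets both branches of a conditional, and all
  passes of a loop, share one bound.\<close>

definition runs :: "com \<Rightarrow> tape list \<Rightarrow> nat \<Rightarrow> tape list \<Rightarrow> bool" where
  "runs c ts T ts' \<longleftrightarrow> (\<exists>t \<le> T. exec c ts t ts')"

lemma computes_within_tm_of:
  assumes "runs c ((0, word_cells x) # replicate (n - 1) (0, word_cells [])) T ts'"
    and "snd (ts' ! 1) = word_cells y"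
  shows "computes_within (tm_of n s c) T x y"
proof -
  let ?M = "tm_of n s c"
  obtain t where t: "t \<le> T"
    "exec c ((0, word_cells x) # replicate (n - 1) (0, word_cells [])) t ts'"
    using assms(1) by (auto simp: runs_def)
  have "(step ?M ^^ t) (init_config ?M x) = (states ?M, ts')"
    using exec_steps[OF t(2), of 0 ?M "csize c"] by (simp add: init_config_def tm_of_def)
  then show ?thesis
    using t(1) assms(2) unfolding computes_within_def by blast
qed

lemma runs_mono: "runs c ts T ts' \<Longrightarrow> T \<le> T' \<Longrightarrow> runs c ts T' ts'"
  unfolding runs_def using le_trans by blast

lemma runs_Write:
  assumes "m < length ts" "ts' = ts[m := act (g (scan ts), d) (ts ! m)]"
  shows "runs (Write m g d) ts 1 ts'"
  unfolding runs_def assms(2) using exec.Write[OF assms(1)] by blast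

lemma runs_Seq:
  "runs a ts T ts' \<Longrightarrow> runs b ts' T' ts'' \<Longrightarrow> runs (a ;; b) ts (T + T') ts''"
  unfolding runs_def using exec.Seq add_mono by blast

lemma runs_Cond:
  assumes "P (scan ts) \<Longrightarrow> runs a ts T ts'" "\<not> P (scan ts) \<Longrightarrow> runs b ts T ts'"
  shows "runs (Cond P a b) ts (Suc T) ts'"
proof (cases "P (scan ts)")
  case True
  then obtain t where "t \<le> T" "exec a ts t ts'" using assms(1) by (auto simp: runs_def)
  then show ?thesis using exec.CondT[of P ts a t ts' b] True by (auto simp: runs_def)
next
  case False
  then obtain t where "t \<le> T" "exec b ts t ts'" using assms(2) by (auto simp: runs_def)
  then show ?thesis using exec.CondF[of P ts b t ts' a] False by (auto simp: runs_def)
qed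

text \<open>\<open>X\<close> lists the tapes at the loop head. Derivations of \<open>exec\<close>
  grow from the last pass backwards, so the induction counts the passes that remain.\<close>

lemma runs_While:
  assumes "\<And>j. j < N \<Longrightarrow> P (scan (X j))" "\<not> P (scan (X N))"
    and "\<And>j. j < N \<Longrightarrow> runs a (X j) T (X (Suc j))"
  shows "runs (While P a) (X 0) (Suc (N * Suc T)) (X N)"
proof -
  have "runs (While P a) (X (N - i)) (Suc (i * Suc T)) (X N)" if "i \<le> N" for i
    using that
  proof (induction i)
    case 0
    then show ?case using exec.WhileF[of P "X N"] assms(2) by (auto simp: runs_def)
  next
    case (Suc i)
    define j where "j = N - Suc i"
    have j: "j < N" "N - i = Suc j" using Suc.prems by (auto simp: j_def)
    obtain t where t: "t \<le> T" "exec a (X j) t (X (Suc j))"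
      using assms(3)[OF j(1)] by (auto simp: runs_def)
    obtain t' where t': "t' \<le> Suc (i * Suc T)" "exec (While P a) (X (Suc j)) t' (X N)"
      using Suc j by (auto simp: runs_def)
    have "exec (While P a) (X j) (Suc (t + t')) (X N)"
      using exec.WhileT[OF assms(1)[OF j(1)] t(2) t'(2)] .
    moreover have "Suc (t + t') \<le> Suc (Suc i * Suc T)" using t t' by simp
    ultimately show ?case unfolding runs_def j_def[symmetric] by blast
  qed
  from this[of N] show ?thesis by simp
qed

section \<open>Unary counters and loops over them\<close>

definition mv :: "nat \<Rightarrow> dir \<Rightarrow> com" where
  "mv m d = Write m (\<lambda>ss. ss ! m) d"

definition put :: "nat \<Rightarrow> nat \<Rightarrow> dir \<Rightarrow> com" where
  "put m s d = Write m (\<lambda>_. s) d"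

definition out :: "(nat list \<Rightarrow> bool) \<Rightarrow> com" where
  "out g = Write 1 (\<lambda>ss. if g ss then 2 else 1) Right"

definition copy :: "nat \<Rightarrow> com" where
  "copy m = Write m (\<lambda>ss. ss ! 0) Right"

text \<open>The unconditional first step is needed because the head may scan the blank behind the
  word; the loop then stops at the blank in cell -1.\<close>

definition rewind :: "nat \<Rightarrow> com" where
  "rewind m = mv m Left ;; While (\<lambda>ss. ss ! m \<noteq> 0) (mv m Left) ;; mv m Right"

definition reset :: "nat \<Rightarrow> com" where
  "reset m = mv m Left ;; While (\<lambda>ss. ss ! m \<noteq> 0) (put m 3 Left) ;; mv m Right"

definition foreach :: "nat \<Rightarrow> com \<Rightarrow> com" where
  "foreach m c = While (\<lambda>ss. ss ! m \<noteq> 0) (c ;; mv m Right) ;; rewind m"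

text \<open>
  During iteration \<open>i\<close> of \<open>formark m c\<close>, cell \<open>j\<close> of tape \<open>m\<close> holds \<open>cmp i j\<close>, so that a nested \<open>foreach m\<close>
  over \<open>j\<close> can compare its index with \<open>i\<close>.
\<close>

definition formark :: "nat \<Rightarrow> com \<Rightarrow> com" where
  "formark m c = While (\<lambda>ss. ss ! m \<noteq> 0)
     (put m 2 Stay ;; rewind m ;; c ;; While (\<lambda>ss. ss ! m = 1) (mv m Right) ;; put m 1 Right) ;;
     reset m"

fun seqs :: "com list \<Rightarrow> com" where
  "seqs [] = mv 0 Stay"
| "seqs (c # cs) = c ;; seqs cs"

lemma runs_mv:
  "m < length ts \<Longrightarrow> h' = h + shift d \<Longrightarrow> runs (mv m d) (ts[m := (h, c)]) 1 (ts[m := (h', c)])"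
  unfolding mv_def by (rule runs_Write) simp_all

lemma runs_put:
  "m < length ts \<Longrightarrow> h' = h + shift d \<Longrightarrow> c' = c(h := s) \<Longrightarrow>
   runs (put m s d) (ts[m := (h, c)]) 1 (ts[m := (h', c')])"
  unfolding put_def by (rule runs_Write) simp_all

text \<open>Only the length of the nonblank stretch counts, which leaves the symbols free to carry
  the marks of an enclosing loop.\<close>

definition unary :: "nat \<Rightarrow> (int \<Rightarrow> nat) \<Rightarrow> bool" where
  "unary N c \<longleftrightarrow> (\<forall>j. 0 \<le> j \<and> j < int N \<longrightarrow> c j \<noteq> 0) \<and> c (- 1) = 0 \<and> c (int N) = 0"

lemma runs_rewind:
  assumes m: "m < length ts" and c: "unary N c" "h \<le> N" "h \<le> l"
  shows "runs (rewind m) (ts[m := (int h, c)]) (2 * l + 3) (ts[m := (0, c)])"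
proof -
  let ?X = "\<lambda>j. ts[m := (int h - 1 - int j, c)]"
  have nz: "c (int h - 1 - int j) \<noteq> 0" if "j < h" for j
    using c(1,2) that unfolding unary_def by auto
  have "runs (mv m Left) (ts[m := (int h, c)]) 1 (?X 0)"
    using m by (intro runs_mv) simp_all
  moreover have "runs (While (\<lambda>ss. ss ! m \<noteq> 0) (mv m Left)) (?X 0) (Suc (h * Suc 1)) (?X h)"
  proof (rule runs_While)
    show "runs (mv m Left) (?X j) 1 (?X (Suc j))" for j
      using m by (intro runs_mv) simp_all
  qed (use nz c(1) m in \<open>simp_all add: unary_def\<close>)
  moreover have "runs (mv m Right) (?X h) 1 (ts[m := (0, c)])"
    using m by (intro runs_mv) simp_all
  ultimately have "runs (rewind m) (ts[m := (int h, c)]) (1 + (Suc (h * Suc 1) + 1)) (ts[m := (0, c)])"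
    unfolding rewind_def by (intro runs_Seq)
  then show ?thesis by (rule runs_mono) (use c(3) in simp)
qed

text \<open>
  Time bounds are polymorphic expressions in the input length, so that applying them to the
  polynomial \<open>[:0, 1:]\<close> yields the required polynomial.
\<close>

definition foreach_time :: "'a::comm_semiring_1 \<Rightarrow> 'a \<Rightarrow> 'a" where
  "foreach_time l T = l * (T + 4) + 4"

lemma runs_foreach:
  assumes len: "\<And>j. m < length (S j)" and c: "unary N c" "N \<le> l"
    and body: "\<And>j. j < N \<Longrightarrow> runs b ((S j)[m := (int j, c)]) T ((S (Suc j))[m := (int j, c)])"
  shows "runs (foreach m b) ((S 0)[m := (0, c)]) (foreach_time l T) ((S N)[m := (0, c)])"
proof -
  let ?X = "\<lambda>j. (S j)[m := (int j, c)]"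
  have "runs (While (\<lambda>ss. ss ! m \<noteq> 0) (b ;; mv m Right)) (?X 0) (Suc (N * Suc (T + 1))) (?X N)"
  proof (rule runs_While)
    fix j assume j: "j < N"
    have "runs (mv m Right) ((S (Suc j))[m := (int j, c)]) 1 (?X (Suc j))"
      using len by (intro runs_mv) simp_all
    then show "runs (b ;; mv m Right) (?X j) (T + 1) (?X (Suc j))"
      by (rule runs_Seq[OF body[OF j]])
  qed (use c len in \<open>simp_all add: unary_def\<close>)
  moreover have "runs (rewind m) (?X N) (2 * N + 3) ((S N)[m := (0, c)])"
    using len c by (intro runs_rewind[where N = N]) simp_all
  ultimately have "runs (foreach m b) (?X 0) (Suc (N * Suc (T + 1)) + (2 * N + 3)) ((S N)[m := (0, c)])"
    unfolding foreach_def by (intro runs_Seq)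
  moreover have "Suc (N * Suc (T + 1)) + (2 * N + 3) \<le> foreach_time l T"
  proof -
    have "N * (T + 4) \<le> l * (T + 4)" using c(2) by (rule mult_le_mono1)
    then show ?thesis by (simp add: foreach_time_def algebra_simps)
  qed
  ultimately show ?thesis by (simp add: runs_mono)
qed

definition marks :: "nat \<Rightarrow> nat \<Rightarrow> int \<Rightarrow> nat" where
  "marks N i j = (if 0 \<le> j \<and> j < int N then cmp i (nat j) else 0)"

text \<open>The contents between two iterations of \<open>formark\<close>; \<open>passed N 0\<close>
  is the unmarked counter.\<close>

definition passed :: "nat \<Rightarrow> nat \<Rightarrow> int \<Rightarrow> nat" where
  "passed N i j = (if 0 \<le> j \<and> j < int N then if j < int i then 1 else 3 else 0)"

lemma unary_marks: "unary N (marks N i)" and unary_passed: "unary N (passed N i)"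
  by (simp_all add: unary_def marks_def passed_def cmp_def)

lemma marks_nth: "j < N \<Longrightarrow> marks N i (int j) = cmp i j"
  by (simp add: marks_def)

lemma passed_mark: "i < N \<Longrightarrow> marks N i = (passed N i)(int i := 2)"
  by (auto simp: fun_eq_iff passed_def marks_def cmp_def split: if_splits)

lemma marks_pass: "i < N \<Longrightarrow> passed N (Suc i) = (marks N i)(int i := 1)"
  by (auto simp: fun_eq_iff passed_def marks_def cmp_def split: if_splits)

lemma passed_reset: "j < N \<Longrightarrow> passed N (N - Suc j) = (passed N (N - j))(int N - 1 - int j := 3)"
  by (auto simp: fun_eq_iff passed_def)

lemma runs_reset:
  assumes m: "m < length ts"
  shows "runs (reset m) (ts[m := (int N, passed N N)]) (2 * N + 3) (ts[m := (0, passed N 0)])"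
proof -
  let ?X = "\<lambda>j. ts[m := (int N - 1 - int j, passed N (N - j))]"
  have "runs (mv m Left) (ts[m := (int N, passed N N)]) 1 (?X 0)"
    using runs_mv[of m ts "int N - 1" "int N" Left "passed N N"] m by simp
  moreover have "runs (While (\<lambda>ss. ss ! m \<noteq> 0) (put m 3 Left)) (?X 0) (Suc (N * Suc 1)) (?X N)"
  proof (rule runs_While)
    fix j assume j: "j < N"
    show "runs (put m 3 Left) (?X j) 1 (?X (Suc j))"
      using m by (intro runs_put passed_reset[OF j]) simp_all
    show "scan (?X j) ! m \<noteq> 0" using m j by (simp add: passed_def)
  qed (use m in \<open>simp add: passed_def\<close>)
  moreover have "runs (mv m Right) (?X N) 1 (ts[m := (0, passed N 0)])"
    using runs_mv[of m ts 0 "- 1" Right "passed N 0"] m by simp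
  ultimately have "runs (reset m) (ts[m := (int N, passed N N)]) (1 + (Suc (N * Suc 1) + 1)) (ts[m := (0, passed N 0)])"
    unfolding reset_def by (intro runs_Seq)
  then show ?thesis by (rule runs_mono) simp
qed

definition formark_time :: "'a::comm_semiring_1 \<Rightarrow> 'a \<Rightarrow> 'a" where
  "formark_time l T = l * (T + 4 * l + 9) + 4"

lemma runs_formark:
  assumes len: "\<And>i. m < length (S i)" and N: "N \<le> l"
    and body: "\<And>i. i < N \<Longrightarrow> runs b ((S i)[m := (0, marks N i)]) T ((S (Suc i))[m := (0, marks N i)])"
  shows "runs (formark m b) ((S 0)[m := (0, passed N 0)]) (formark_time l T) ((S N)[m := (0, passed N 0)])"
proof -
  let ?X = "\<lambda>i. (S i)[m := (int i, passed N i)]"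
  let ?b = "put m 2 Stay ;; rewind m ;; b ;; While (\<lambda>ss. ss ! m = 1) (mv m Right) ;; put m 1 Right"
  let ?T = "T + 4 * N + 6"
  have "runs (While (\<lambda>ss. ss ! m \<noteq> 0) ?b) (?X 0) (Suc (N * Suc ?T)) (?X N)"
  proof (rule runs_While)
    fix i assume i: "i < N"
    show "scan (?X i) ! m \<noteq> 0" using len i by (simp add: passed_def)
    have "runs (put m 2 Stay) (?X i) 1 ((S i)[m := (int i, marks N i)])"
      using len passed_mark[OF i] by (intro runs_put) (simp_all only: shift.simps add_0_right)
    moreover have "runs (rewind m) ((S i)[m := (int i, marks N i)]) (2 * i + 3)
        ((S i)[m := (0, marks N i)])"
      using len i by (intro runs_rewind[OF _ unary_marks[of N i]]) simp_all
    moreover note body[OF i]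
    \<comment> \<open>The body ends with the head on cell 0. The current index is found again
      because the cells before it hold 1 and it alone holds 2.\<close>
    moreover have "runs (While (\<lambda>ss. ss ! m = 1) (mv m Right)) ((S (Suc i))[m := (0, marks N i)])
        (Suc (i * Suc 1)) ((S (Suc i))[m := (int i, marks N i)])"
    proof (rule runs_While[where X = "\<lambda>j. (S (Suc i))[m := (int j, marks N i)]", simplified of_nat_0])
      fix j assume j: "j < i"
      show "scan ((S (Suc i))[m := (int j, marks N i)]) ! m = 1"
        using len j i by (simp add: marks_nth cmp_def)
      show "runs (mv m Right) ((S (Suc i))[m := (int j, marks N i)]) 1 ((S (Suc i))[m := (int (Suc j), marks N i)])"
        using len by (intro runs_mv) simp_all
    qed (use len i in \<open>simp add: marks_nth cmp_def\<close>)
    moreover have "runs (put m 1 Right) ((S (Suc i))[m := (int i, marks N i)]) 1 (?X (Suc i))"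
      using len marks_pass[OF i] by (intro runs_put) (simp_all only: shift.simps of_nat_Suc add.commute)
    ultimately have "runs ?b (?X i) (1 + (2 * i + 3 + (T + (Suc (i * Suc 1) + 1)))) (?X (Suc i))"
      by (intro runs_Seq)
    then show "runs ?b (?X i) ?T (?X (Suc i))" by (rule runs_mono) (use i in simp)
  qed (use len in \<open>simp add: passed_def\<close>)
  moreover have "runs (reset m) (?X N) (2 * N + 3) ((S N)[m := (0, passed N 0)])"
    using len by (intro runs_reset) simp_all
  ultimately have "runs (formark m b) (?X 0) (Suc (N * Suc ?T) + (2 * N + 3)) ((S N)[m := (0, passed N 0)])"
    unfolding formark_def by (intro runs_Seq)
  moreover have "Suc (N * Suc ?T) + (2 * N + 3) \<le> formark_time l T"
  proof -
    have "N * (T + 4 * N + 9) \<le> l * (T + 4 * l + 9)" using N by (intro mult_le_mono) simp_all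
    then show ?thesis by (simp add: formark_time_def algebra_simps)
  qed
  ultimately show ?thesis by (simp add: runs_mono)
qed

lemma upd5:
  "[a, b, c, d, e][0 := x] = [x, b, c, d, e]"
  "[a, b, c, d, e][1 := x] = [a, x, c, d, e]"
  "[a, b, c, d, e][Suc 0 := x] = [a, x, c, d, e]"
  "[a, b, c, d, e][2 := x] = [a, b, x, d, e]"
  "[a, b, c, d, e][3 := x] = [a, b, c, x, e]"
  "[a, b, c, d, e][4 := x] = [a, b, c, d, x]"
  by (simp_all add: eval_nat_numeral)

lemma runs_foreach2:
  assumes "unary N c" "N \<le> l"
    and "\<And>j. j < N \<Longrightarrow> runs b [A j, W j, (int j, c), J, B] T [A (Suc j), W (Suc j), (int j, c), J, B]"
  shows "runs (foreach 2 b) [A 0, W 0, (0, c), J, B] (foreach_time l T) [A N, W N, (0, c), J, B]"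
  using runs_foreach[of 2 "\<lambda>j. [A j, W j, (0, c), J, B]" N c l b T] assms by (simp add: upd5)

lemma runs_foreach3:
  assumes "unary N c" "N \<le> l"
    and "\<And>j. j < N \<Longrightarrow> runs b [A j, W j, V, (int j, c), B] T [A (Suc j), W (Suc j), V, (int j, c), B]"
  shows "runs (foreach 3 b) [A 0, W 0, V, (0, c), B] (foreach_time l T) [A N, W N, V, (0, c), B]"
  using runs_foreach[of 3 "\<lambda>j. [A j, W j, V, (0, c), B]" N c l b T] assms by (simp add: upd5)

lemma runs_formark2:
  assumes "N \<le> l"
    and "\<And>i. i < N \<Longrightarrow> runs b [A i, W i, (0, marks N i), J, B] T [A (Suc i), W (Suc i), (0, marks N i), J, B]"
  shows "runs (formark 2 b) [A 0, W 0, (0, passed N 0), J, B] (formark_time l T) [A N, W N, (0, passed N 0), J, B]"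
  using runs_formark[of 2 "\<lambda>j. [A j, W j, (0, passed N 0), J, B]" N l b T] assms by (simp add: upd5)

lemma runs_formark3:
  assumes "N \<le> l"
    and "\<And>i. i < N \<Longrightarrow> runs b [A i, W i, V, (0, marks N i), B] T [A (Suc i), W (Suc i), V, (0, marks N i), B]"
  shows "runs (formark 3 b) [A 0, W 0, V, (0, passed N 0), B] (formark_time l T) [A N, W N, V, (0, passed N 0), B]"
  using runs_formark[of 3 "\<lambda>j. [A j, W j, V, (0, passed N 0), B]" N l b T] assms by (simp add: upd5)

section \<open>The reduction machine\<close>

abbreviation bit :: "bool \<Rightarrow> nat" where
  "bit b \<equiv> (if b then 2 else 1)"

abbreviation outT :: "bool list \<Rightarrow> tape" where
  "outT w \<equiv> (int (length w), word_cells w)"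

lemma word_cells_nth: "i < length w \<Longrightarrow> word_cells w (int i) = bit (w ! i)"
  by (simp add: word_cells_def)

lemma word_cells_end: "word_cells w (int (length w)) = 0"
  by (simp add: word_cells_def)

lemma word_cells_update:
  "(word_cells (xs @ b # ys))(int (length xs) := bit b') = word_cells (xs @ b' # ys)"
  by (auto simp: fun_eq_iff word_cells_def nth_append nth_Cons nat_eq_iff split: nat.splits)

lemma word_cells_snoc: "(word_cells xs)(int (length xs) := bit b) = word_cells (xs @ [b])"
  by (auto simp: fun_eq_iff word_cells_def nth_append nat_eq_iff nat_less_iff)

lemma unary_word_cells: "unary (length w) (word_cells w)"
  by (simp add: unary_def word_cells_def)

lemma passed_0: "word_cells [] = passed 0 0"
  by (simp add: fun_eq_iff word_cells_def passed_def)

lemma passed_Suc: "passed (Suc j) 0 = (passed j 0)(int j := 3)"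
  by (auto simp: fun_eq_iff passed_def)

lemma runs_mv5:
  "runs (mv 0 d) [(h, c), W, V, J, B] 1 [(h + shift d, c), W, V, J, B]"
  "runs (mv 2 d) [A, W, (h, c), J, B] 1 [A, W, (h + shift d, c), J, B]"
  using runs_mv[of 0 "[(h, c), W, V, J, B]"] runs_mv[of 2 "[A, W, (h, c), J, B]"]
  by (simp_all add: upd5)

lemma runs_put5:
  "runs (put 1 s d) [A, (h, c), V, J, B] 1 [A, (h + shift d, c(h := s)), V, J, B]"
  "runs (put 2 s d) [A, W, (h, c), J, B] 1 [A, W, (h + shift d, c(h := s)), J, B]"
  "runs (put 3 s d) [A, W, V, (h, c), B] 1 [A, W, V, (h + shift d, c(h := s)), B]"
  "runs (put 4 s d) [A, W, V, J, (h, c)] 1 [A, W, V, J, (h + shift d, c(h := s))]"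
  using runs_put[of 1 "[A, (h, c), V, J, B]"] runs_put[of 2 "[A, W, (h, c), J, B]"]
    runs_put[of 3 "[A, W, V, (h, c), B]"] runs_put[of 4 "[A, W, V, J, (h, c)]"]
  by (simp_all add: upd5)

lemma runs_copy5:
  "runs (copy 1) [(h, c), (h', c'), V, J, B] 1 [(h, c), (h' + 1, c'(h' := c h)), V, J, B]"
  "runs (copy 4) [(h, c), W, V, J, (h', c')] 1 [(h, c), W, V, J, (h' + 1, c'(h' := c h))]"
  unfolding copy_def by (rule runs_Write; simp add: upd5)+

lemma runs_rewind5:
  assumes "unary N c" "h \<le> N" "h \<le> l"
  shows "runs (rewind 0) [(int h, c), W, V, J, B] (2 * l + 3) [(0, c), W, V, J, B]"
    "runs (rewind 2) [A, W, (int h, c), J, B] (2 * l + 3) [A, W, (0, c), J, B]"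
    "runs (rewind 3) [A, W, V, (int h, c), B] (2 * l + 3) [A, W, V, (0, c), B]"
    "runs (rewind 4) [A, W, V, J, (int h, c)] (2 * l + 3) [A, W, V, J, (0, c)]"
  using runs_rewind[OF _ assms, of 0 "[(int h, c), W, V, J, B]"]
    runs_rewind[OF _ assms, of 2 "[A, W, (int h, c), J, B]"]
    runs_rewind[OF _ assms, of 3 "[A, W, V, (int h, c), B]"]
    runs_rewind[OF _ assms, of 4 "[A, W, V, J, (int h, c)]"]
  by (simp_all add: upd5)

lemma runs_out:
  "runs (out g) [A, outT w, V, J, B] 1 [A, outT (w @ [g (scan [A, outT w, V, J, B])]), V, J, B]"
  unfolding out_def
  by (rule runs_Write) (simp_all add: upd5 word_cells_snoc[symmetric] del: fun_upd_apply)

lemma runs_seqs: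
  assumes "\<And>x w. x \<in> set xs \<Longrightarrow> runs (f x) [(h, c), outT w, V, J, B] T [(h, c), outT (w @ g x), V, J, B]"
  shows "runs (seqs (map f xs)) [(h, c), outT w, V, J, B] (length xs * T + 1)
    [(h, c), outT (w @ concat (map g xs)), V, J, B]"
  using assms
proof (induction xs arbitrary: w)
  case Nil
  show ?case using runs_mv5(1)[of Stay h c] by simp
next
  case (Cons x xs)
  have "runs (seqs (map f (x # xs))) [(h, c), outT w, V, J, B] (T + (length xs * T + 1))
      [(h, c), outT ((w @ g x) @ concat (map g xs)), V, J, B]"
    unfolding list.map seqs.simps using Cons by (intro runs_Seq[OF Cons.prems Cons.IH]) simp_all
  then show ?case by (simp add: add.assoc)
qed

section \<open>Writing the entries of the new adjacency matrix\<close>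

definition edge_bit :: "tag \<Rightarrow> tag \<Rightarrow> nat \<Rightarrow> bool \<Rightarrow> bool \<Rightarrow> bool \<Rightarrow> bool" where
  "edge_bit t t' c eq e p \<longleftrightarrow> unprot t t' c (e \<and> \<not> p) \<or> link t t' c eq e"

definition prot_bit :: "tag \<Rightarrow> tag \<Rightarrow> nat \<Rightarrow> bool \<Rightarrow> bool \<Rightarrow> bool \<Rightarrow> bool" where
  "prot_bit t t' c eq e p \<longleftrightarrow> link t t' c eq e \<and> \<not> unprot t t' c (e \<and> \<not> p)"

definition block :: "tag \<Rightarrow> nat \<Rightarrow> bool \<Rightarrow> bool \<Rightarrow> bool \<Rightarrow> bool list" where
  "block t c eq e p = concat (map (\<lambda>t'. [edge_bit t t' c eq e p, prot_bit t t' c eq e p]) tags)"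

definition emit :: "tag \<Rightarrow> bool \<Rightarrow> bool \<Rightarrow> com" where
  "emit t e p = seqs (map (\<lambda>t'.
     out (\<lambda>ss. edge_bit t t' (ss ! 3) (ss ! 2 = 2) e p) ;;
     out (\<lambda>ss. prot_bit t t' (ss ! 3) (ss ! 2 = 2) e p)) tags)"

lemma runs_emit:
  "runs (emit t e p) [(h, c), outT w, (hv, cv), (hj, cj), B] 33
     [(h, c), outT (w @ block t (cj hj) (cv hv = 2) e p), (hv, cv), (hj, cj), B]"
proof -
  have "runs (out (\<lambda>ss. edge_bit t t' (ss ! 3) (ss ! 2 = 2) e p) ;;
      out (\<lambda>ss. prot_bit t t' (ss ! 3) (ss ! 2 = 2) e p)) [(h, c), outT w, (hv, cv), (hj, cj), B] 2
      [(h, c), outT (w @ [edge_bit t t' (cj hj) (cv hv = 2) e p, prot_bit t t' (cj hj) (cv hv = 2) e p]),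
        (hv, cv), (hj, cj), B]" for t' w
    using runs_Seq[OF
        runs_out[of "\<lambda>ss. edge_bit t t' (ss ! 3) (ss ! 2 = 2) e p" "(h, c)" w "(hv, cv)" "(hj, cj)" B]
        runs_out[of "\<lambda>ss. prot_bit t t' (ss ! 3) (ss ! 2 = 2) e p" "(h, c)" _ "(hv, cv)" "(hj, cj)" B]]
    by (simp add: numeral_2_eq_2)
  from runs_seqs[of tags, OF this] show ?thesis
    unfolding emit_def block_def by (simp add: length_tags)
qed

text \<open>The two input bits are remembered by branching into four copies of \<open>emit\<close>.
  The other arguments are scanned meanwhile: in \<open>runs_row\<close> tape 2 shows 2 iff the
  original vertices coincide, and tape 3 shows the comparison of the tracks.\<close>

definition entry :: "tag \<Rightarrow> com" where
  "entry t = Cond (\<lambda>ss. ss ! 0 = 2)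
     (mv 0 Right ;; Cond (\<lambda>ss. ss ! 0 = 2) (emit t True True) (emit t True False))
     (mv 0 Right ;; Cond (\<lambda>ss. ss ! 0 = 2) (emit t False True) (emit t False False)) ;;
   mv 0 Right"

lemma runs_entry:
  assumes "Suc p < length x"
  shows "runs (entry t) [(int p, word_cells x), outT w, (hv, cv), (hj, cj), B] 37
     [(int (p + 2), word_cells x), outT (w @ block t (cj hj) (cv hv = 2) (x ! p) (x ! Suc p)), (hv, cv), (hj, cj), B]"
proof -
  let ?A = "\<lambda>p. (int p, word_cells x)"
  let ?w = "w @ block t (cj hj) (cv hv = 2) (x ! p) (x ! Suc p)"
  let ?s = "[?A (Suc p), outT w, (hv, cv), (hj, cj), B]"
  let ?s' = "[?A (Suc p), outT ?w, (hv, cv), (hj, cj), B]"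
  have s: "word_cells x (int p) = bit (x ! p)" "word_cells x (int (Suc p)) = bit (x ! Suc p)"
    using assms by (intro word_cells_nth; simp)+
  have mv: "runs (mv 0 Right) [?A q, W, V, J, B] 1 [?A (Suc q), W, V, J, B]" for q W V J
    using runs_mv5(1)[of Right "int q"] by (simp add: add.commute)
  have em: "runs (Cond (\<lambda>ss. ss ! 0 = 2) (emit t e True) (emit t e False)) ?s (Suc 33) ?s'" if "e = x ! p" for e
    by (rule runs_Cond; use s(2) that runs_emit[of t e "x ! Suc p"] in \<open>simp split: if_splits\<close>)
  have "runs (Cond (\<lambda>ss. ss ! 0 = 2)
     (mv 0 Right ;; Cond (\<lambda>ss. ss ! 0 = 2) (emit t True True) (emit t True False))
     (mv 0 Right ;; Cond (\<lambda>ss. ss ! 0 = 2) (emit t False True) (emit t False False)))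
     [?A p, outT w, (hv, cv), (hj, cj), B] (Suc (1 + Suc 33)) ?s'"
    by (rule runs_Cond; intro runs_Seq[OF mv em]; use s(1) in \<open>simp split: if_splits\<close>)
  from runs_Seq[OF this mv] show ?thesis unfolding entry_def by (simp add: add.commute)
qed

definition skip2 :: "dir \<Rightarrow> com" where
  "skip2 d = mv 0 d ;; mv 0 d"

lemma runs_skip2:
  "runs (skip2 Right) [(h, c), W, V, J, B] 2 [(h + 2, c), W, V, J, B]"
  "runs (skip2 Left) [(h, c), W, V, J, B] 2 [(h - 2, c), W, V, J, B]"
  unfolding skip2_def
  using runs_Seq[OF runs_mv5(1)[of Right h c W V J B] runs_mv5(1)[of Right]]
    runs_Seq[OF runs_mv5(1)[of Left h c W V J B] runs_mv5(1)[of Left]]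
  by (simp_all add: add.assoc numeral_2_eq_2)

lemma runs_skip_row:
  assumes "unary n c'" "n \<le> l"
  shows "runs (foreach 2 (skip2 Right)) [(h, c), W, (0, c'), J, B] (foreach_time l 2)
      [(h + 2 * int n, c), W, (0, c'), J, B]"
    "runs (foreach 2 (skip2 Left)) [(h, c), W, (0, c'), J, B] (foreach_time l 2)
      [(h - 2 * int n, c), W, (0, c'), J, B]"
proof -
  show "runs (foreach 2 (skip2 Right)) [(h, c), W, (0, c'), J, B] (foreach_time l 2)
      [(h + 2 * int n, c), W, (0, c'), J, B]"
    using runs_foreach2[OF assms, of "skip2 Right" "\<lambda>j. (h + 2 * int j, c)" "\<lambda>_. W" J B 2]
      runs_skip2(1)[of "h + 2 * int j" for j]
    by (simp add: algebra_simps)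
  show "runs (foreach 2 (skip2 Left)) [(h, c), W, (0, c'), J, B] (foreach_time l 2)
      [(h - 2 * int n, c), W, (0, c'), J, B]"
    using runs_foreach2[OF assms, of "skip2 Left" "\<lambda>j. (h - 2 * int j, c)" "\<lambda>_. W" J B 2]
      runs_skip2(2)[of "h - 2 * int j" for j]
    by (simp add: algebra_simps)
qed

text \<open>Both loops share tape 2: the inner loop needs only nonblank cells and leaves the marks
  of the outer one untouched.\<close>

definition skip_matrix :: "dir \<Rightarrow> com" where
  "skip_matrix d = formark 2 (foreach 2 (skip2 d))"

lemma runs_skip_matrix:
  assumes "n \<le> l"
  shows "runs (skip_matrix Right) [(h, c), W, (0, passed n 0), J, B] (formark_time l (foreach_time l 2))
      [(h + 2 * int n * int n, c), W, (0, passed n 0), J, B]"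
    "runs (skip_matrix Left) [(h, c), W, (0, passed n 0), J, B] (formark_time l (foreach_time l 2))
      [(h - 2 * int n * int n, c), W, (0, passed n 0), J, B]"
proof -
  show "runs (skip_matrix Right) [(h, c), W, (0, passed n 0), J, B] (formark_time l (foreach_time l 2))
      [(h + 2 * int n * int n, c), W, (0, passed n 0), J, B]"
    unfolding skip_matrix_def
    using runs_formark2[OF assms, of "foreach 2 (skip2 Right)" "\<lambda>i. (h + 2 * int n * int i, c)" "\<lambda>_. W" J B "foreach_time l 2"]
      runs_skip_row(1)[OF unary_marks assms, where h = "h + 2 * int n * int i" for i]
    by (simp add: algebra_simps)
  show "runs (skip_matrix Left) [(h, c), W, (0, passed n 0), J, B] (formark_time l (foreach_time l 2))
      [(h - 2 * int n * int n, c), W, (0, passed n 0), J, B]"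
    unfolding skip_matrix_def
    using runs_formark2[OF assms, of "foreach 2 (skip2 Left)" "\<lambda>i. (h - 2 * int n * int i, c)" "\<lambda>_. W" J B "foreach_time l 2"]
      runs_skip_row(2)[OF unary_marks assms, where h = "h - 2 * int n * int i" for i]
    by (simp add: algebra_simps)
qed

lemma length_concat_map_upt:
  "(\<And>u. u < n \<Longrightarrow> length (f u) = d) \<Longrightarrow> length (concat (map f [0..<n])) = n * d"
  by (induction n) simp_all

lemma nth_concat_map_upt:
  assumes "\<And>u. u < n \<Longrightarrow> length (f u) = d" "u < n" "v < d"
  shows "concat (map f [0..<n]) ! (u * d + v) = f u ! v"
  using assms
proof (induction n)
  case (Suc n)
  have len: "length (concat (map f [0..<n])) = n * d"
    using Suc.prems by (intro length_concat_map_upt) simp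
  show ?case
  proof (cases "u = n")
    case True
    then show ?thesis using len by (simp add: nth_append)
  next
    case False
    then have "u < n" using Suc.prems by simp
    then have "Suc u * d \<le> n * d" by (intro mult_le_mono1) simp
    then have "u * d + v < n * d" using Suc.prems by simp
    then show ?thesis using Suc \<open>u < n\<close> len by (simp add: nth_append)
  qed
qed simp

text \<open>
  Tape 0 is the input, tape 1 the output; tapes 2 and 3 hold \<open>n\<close> and \<open>K\<close> in unary as loop counters, and
  tape 4 a binary copy of \<open>k\<close> that is counted down to find \<open>K = min k n\<close>.
\<close>

definition row :: "tag \<Rightarrow> com" where
  "row t = foreach 3 (foreach 2 (entry t) ;; foreach 2 (skip2 Left))"

text \<open>Rows run through track, vertex and tag, and so do columns, with the tag varying fastest.
  The row loops over track and vertex use \<open>formark\<close>, so that the column loops on the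
  same tapes can read off comparisons.\<close>

definition matrix :: com where
  "matrix = formark 3 (formark 2 (seqs (map row tags) ;; foreach 2 (skip2 Right)) ;; skip_matrix Left)"

definition load :: com where
  "load = While (\<lambda>ss. ss ! 0 = 2) (put 2 3 Right ;; mv 0 Right) ;; mv 0 Right ;; rewind 2"

definition copy_bits :: com where
  "copy_bits = While (\<lambda>ss. ss ! 0 \<noteq> 0) (copy 4 ;; mv 0 Right) ;; rewind 4"

definition to_matrix :: com where
  "to_matrix = rewind 0 ;; While (\<lambda>ss. ss ! 0 = 2) (mv 0 Right) ;; mv 0 Right"

text \<open>If the binary counter is already zero, the head of tape 2 runs to the end, which stops \<open>count\<close>.\<close>

definition decrement :: com where
  "decrement = While (\<lambda>ss. ss ! 4 = 1) (put 4 2 Right) ;;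
     Cond (\<lambda>ss. ss ! 4 = 2)
       (put 4 1 Stay ;; put 3 3 Right ;; mv 2 Right)
       (While (\<lambda>ss. ss ! 2 \<noteq> 0) (mv 2 Right)) ;;
     rewind 4"

definition count :: com where
  "count = While (\<lambda>ss. ss ! 2 \<noteq> 0) decrement ;; rewind 2 ;; rewind 3"

definition header :: com where
  "header = foreach 3 (foreach 2 (seqs (map (\<lambda>_. out (\<lambda>_. True)) tags))) ;; out (\<lambda>_. False)"

text \<open>The move of the input head after \<open>put 1 2 Right\<close> drops the zero that has
  just been replaced by a one; if the carry has run past the last bit, it moves over blanks.\<close>

definition add_two :: com where
  "add_two = copy 1 ;; mv 0 Right ;;
     While (\<lambda>ss. ss ! 0 = 2) (put 1 1 Right ;; mv 0 Right) ;; put 1 2 Right ;; mv 0 Right ;;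
     While (\<lambda>ss. ss ! 0 \<noteq> 0) (copy 1 ;; mv 0 Right)"

definition reducer :: com where
  "reducer = load ;; skip_matrix Right ;; copy_bits ;; to_matrix ;; count ;; header ;; matrix ;;
     skip_matrix Right ;; add_two"

lemma wf_mv: "m < 5 \<Longrightarrow> wf_com 5 4 (mv m d)"
  by (auto simp: mv_def subset_iff)

lemma wf_put: "m < 5 \<Longrightarrow> s < 4 \<Longrightarrow> wf_com 5 4 (put m s d)"
  by (simp add: put_def)

lemma wf_out: "wf_com 5 4 (out g)"
  by (simp add: out_def)

lemma wf_copy: "m < 5 \<Longrightarrow> wf_com 5 4 (copy m)"
  by (auto simp: copy_def subset_iff)

lemma wf_seqs: "(\<And>c. c \<in> set cs \<Longrightarrow> wf_com 5 4 c) \<Longrightarrow> wf_com 5 4 (seqs cs)"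
  by (induction cs) (simp_all add: wf_mv)

lemma wf_reducer: "wf_com 5 4 reducer"
  by (auto simp: reducer_def load_def skip_matrix_def copy_bits_def to_matrix_def count_def decrement_def
      header_def matrix_def row_def add_two_def foreach_def formark_def rewind_def reset_def skip2_def
      entry_def emit_def wf_mv wf_put wf_out wf_copy intro!: wf_seqs)

section \<open>Counting down a binary number\<close>

fun bits_val :: "bool list \<Rightarrow> nat" where
  "bits_val [] = 0"
| "bits_val (b # bs) = of_bool b + 2 * bits_val bs"

text \<open>Counting down keeps the word length and thus creates leading zeros, so counter words are
  described by their value instead of as \<open>nat_bits\<close> of a number.\<close>

lemma bits_val_nat_bits: "bits_val (nat_bits k) = k"
proof (induction k rule: less_induct)
  case (less k)
  show ?case
  proof (cases "k = 0")
    case False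
    then show ?thesis
      using less[of "k div 2"] by (simp add: nat_bits.simps[of k] odd_two_times_div_two_succ)
  qed (simp add: nat_bits.simps)
qed

lemma bits_val_pos:
  "0 < bits_val bs \<Longrightarrow> \<exists>a ys. bs = replicate a False @ True # ys"
proof (induction bs)
  case (Cons b bs)
  show ?case
  proof (cases b)
    case True
    then show ?thesis by (intro exI[of _ 0]) simp
  next
    case False
    then obtain a ys where "bs = replicate a False @ True # ys" using Cons by auto
    then show ?thesis using False by (intro exI[of _ "Suc a"] exI[of _ ys]) simp
  qed
qed simp

lemma bits_val_zero: "bits_val bs = 0 \<Longrightarrow> bs = replicate (length bs) False"
  by (induction bs) auto

lemma bits_val_dec:
  "bits_val (replicate a False @ True # ys) = Suc (bits_val (replicate a True @ False # ys))"
  by (induction a) auto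

text \<open>The hypothesis admits both ways in which the borrow can stop: at a one, or at the end of
  a word of zeros.\<close>

lemma runs_ripple:
  assumes "ys = [] \<or> hd ys"
  shows "runs (While (\<lambda>ss. ss ! 4 = 1) (put 4 2 Right)) [A, W, V, J, (0, word_cells (replicate a False @ ys))]
    (Suc (a * 2)) [A, W, V, J, (int a, word_cells (replicate a True @ ys))]"
proof -
  let ?c = "\<lambda>j. word_cells (replicate j True @ replicate (a - j) False @ ys)"
  let ?X = "\<lambda>j. [A, W, V, J, (int j, ?c j)]"
  have "runs (While (\<lambda>ss. ss ! 4 = 1) (put 4 2 Right)) (?X 0) (Suc (a * Suc 1)) (?X a)"
  proof (rule runs_While)
    fix j assume j: "j < a"
    then obtain r where r: "a - j = Suc r" "a - Suc j = r" by (metis Suc_diff_Suc)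
    have e: "replicate (Suc j) True @ replicate r False @ ys = replicate j True @ True # replicate r False @ ys"
      by (simp add: replicate_app_Cons_same)
    show "scan (?X j) ! 4 = 1"
      using word_cells_nth[of j "replicate j True @ False # replicate r False @ ys"]
      by (simp add: r nth_append)
    have "(?c j)(int j := 2) = ?c (Suc j)"
      using word_cells_update[of "replicate j True" False "replicate r False @ ys" True]
      unfolding r e by simp
    then show "runs (put 4 2 Right) (?X j) 1 (?X (Suc j))"
      using runs_put5(4)[of 2 Right A W V J "int j" "?c j"] by (simp add: add.commute)
  next
    show "\<not> scan (?X a) ! 4 = 1"
    proof (cases ys)
      case Nil
      then show ?thesis using word_cells_end[of "replicate a True"] by simp
    next
      case (Cons y zs)
      then show ?thesis using word_cells_nth[of a "replicate a True @ y # zs"] assms by (simp add: nth_append)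
    qed
  qed
  then show ?thesis by (simp add: numeral_2_eq_2)
qed

lemma runs_decrement_pos:
  assumes bs: "0 < bits_val bs" and l: "length bs \<le> l"
  shows "\<exists>bs'. length bs' = length bs \<and> bits_val bs = Suc (bits_val bs') \<and>
    runs decrement [A, W, (hv, cv), (int j, passed j 0), (0, word_cells bs)] (4 * l + 8)
      [A, W, (hv + 1, cv), (int (Suc j), passed (Suc j) 0), (0, word_cells bs')]"
proof -
  obtain a ys where b: "bs = replicate a False @ True # ys" using bits_val_pos[OF bs] by blast
  let ?b = "replicate a True @ False # ys"
  have "runs (put 4 1 Stay) [A, W, (hv, cv), (int j, passed j 0), (int a, word_cells (replicate a True @ True # ys))] 1
      [A, W, (hv, cv), (int j, passed j 0), (int a, word_cells ?b)]"
    using runs_put5(4)[of 1 Stay A W "(hv, cv)" "(int j, passed j 0)" "int a"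
        "word_cells (replicate a True @ True # ys)"] word_cells_update[of "replicate a True" True ys False]
    by simp
  moreover have "runs (put 3 3 Right) [A, W, (hv, cv), (int j, passed j 0), (int a, word_cells ?b)] 1
      [A, W, (hv, cv), (int (Suc j), passed (Suc j) 0), (int a, word_cells ?b)]"
    using runs_put5(3)[of 3 Right A W "(hv, cv)" "int j" "passed j 0"] by (simp add: passed_Suc add.commute)
  moreover have "runs (mv 2 Right) [A, W, (hv, cv), (int (Suc j), passed (Suc j) 0), (int a, word_cells ?b)] 1
      [A, W, (hv + 1, cv), (int (Suc j), passed (Suc j) 0), (int a, word_cells ?b)]"
    using runs_mv5(2)[of Right A W hv cv] by simp
  ultimately have step: "runs (put 4 1 Stay ;; put 3 3 Right ;; mv 2 Right)
      [A, W, (hv, cv), (int j, passed j 0), (int a, word_cells (replicate a True @ True # ys))] (1 + (1 + 1))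
      [A, W, (hv + 1, cv), (int (Suc j), passed (Suc j) 0), (int a, word_cells ?b)]"
    by (intro runs_Seq)
  have "word_cells (replicate a True @ True # ys) (int a) = 2"
    using word_cells_nth[of a "replicate a True @ True # ys"] by (simp add: nth_append)
  then have "runs (Cond (\<lambda>ss. ss ! 4 = 2) (put 4 1 Stay ;; put 3 3 Right ;; mv 2 Right) (While (\<lambda>ss. ss ! 2 \<noteq> 0) (mv 2 Right)))
      [A, W, (hv, cv), (int j, passed j 0), (int a, word_cells (replicate a True @ True # ys))] (Suc (1 + (1 + 1)))
      [A, W, (hv + 1, cv), (int (Suc j), passed (Suc j) 0), (int a, word_cells ?b)]"
    using step by (intro runs_Cond) simp_all
  moreover have "runs (While (\<lambda>ss. ss ! 4 = 1) (put 4 2 Right)) [A, W, (hv, cv), (int j, passed j 0), (0, word_cells bs)]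
      (Suc (a * 2)) [A, W, (hv, cv), (int j, passed j 0), (int a, word_cells (replicate a True @ True # ys))]"
    unfolding b by (rule runs_ripple) simp
  moreover have "runs (rewind 4) [A, W, (hv + 1, cv), (int (Suc j), passed (Suc j) 0), (int a, word_cells ?b)] (2 * l + 3)
      [A, W, (hv + 1, cv), (int (Suc j), passed (Suc j) 0), (0, word_cells ?b)]"
    using l b by (intro runs_rewind5(4)[OF unary_word_cells]) simp_all
  ultimately have "runs decrement [A, W, (hv, cv), (int j, passed j 0), (0, word_cells bs)]
      (Suc (a * 2) + (Suc (1 + (1 + 1)) + (2 * l + 3)))
      [A, W, (hv + 1, cv), (int (Suc j), passed (Suc j) 0), (0, word_cells ?b)]"
    unfolding decrement_def by (intro runs_Seq)
  then have "runs decrement [A, W, (hv, cv), (int j, passed j 0), (0, word_cells bs)] (4 * l + 8)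
      [A, W, (hv + 1, cv), (int (Suc j), passed (Suc j) 0), (0, word_cells ?b)]"
    by (rule runs_mono) (use l b in simp)
  then show ?thesis using b bits_val_dec[of a ys] by (intro exI[of _ ?b]) simp
qed

text \<open>The borrow runs off the end and leaves a word of ones. This wrong value does no damage,
  since the same pass exhausts tape 2 and thereby ends \<open>count\<close>.\<close>

lemma runs_decrement_zero:
  assumes bs: "bits_val bs = 0" and l: "length bs \<le> l" "n \<le> l" "j \<le> n"
  shows "runs decrement [A, W, (int j, passed n 0), J, (0, word_cells bs)] (6 * l + 8)
      [A, W, (int n, passed n 0), J, (0, word_cells (replicate (length bs) True))]"
proof -
  let ?a = "length bs"
  let ?b = "word_cells (replicate ?a True)"
  have "runs (While (\<lambda>ss. ss ! 4 = 1) (put 4 2 Right)) [A, W, (int j, passed n 0), J, (0, word_cells (replicate ?a False @ []))]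
      (Suc (?a * 2)) [A, W, (int j, passed n 0), J, (int ?a, word_cells (replicate ?a True @ []))]"
    by (rule runs_ripple) simp
  then have 1: "runs (While (\<lambda>ss. ss ! 4 = 1) (put 4 2 Right)) [A, W, (int j, passed n 0), J, (0, word_cells bs)]
      (Suc (?a * 2)) [A, W, (int j, passed n 0), J, (int ?a, ?b)]"
    using bits_val_zero[OF bs] by simp
  let ?X = "\<lambda>i. [A, W, (int (j + i), passed n 0), J, (int ?a, ?b)]"
  have "runs (While (\<lambda>ss. ss ! 2 \<noteq> 0) (mv 2 Right)) (?X 0) (Suc ((n - j) * Suc 1)) (?X (n - j))"
  proof (rule runs_While)
    show "runs (mv 2 Right) (?X i) 1 (?X (Suc i))" for i
      using runs_mv5(2)[of Right A W "int (j + i)" "passed n 0"] by (simp add: ac_simps)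
  qed (use l in \<open>simp_all add: passed_def\<close>)
  moreover have "?b (int ?a) = 0" using word_cells_end[of "replicate ?a True"] by simp
  ultimately have 2: "runs (Cond (\<lambda>ss. ss ! 4 = 2) (put 4 1 Stay ;; put 3 3 Right ;; mv 2 Right) (While (\<lambda>ss. ss ! 2 \<noteq> 0) (mv 2 Right)))
      [A, W, (int j, passed n 0), J, (int ?a, ?b)] (Suc (Suc ((n - j) * Suc 1))) [A, W, (int n, passed n 0), J, (int ?a, ?b)]"
    using l(3) by (intro runs_Cond) simp_all
  have 3: "runs (rewind 4) [A, W, (int n, passed n 0), J, (int ?a, ?b)] (2 * l + 3) [A, W, (int n, passed n 0), J, (0, ?b)]"
    using l by (intro runs_rewind5(4)[OF unary_word_cells]) simp_all
  from runs_Seq[OF 1 runs_Seq[OF 2 3]] show ?thesis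
    unfolding decrement_def by (rule runs_mono) (use l in simp)
qed

lemma runs_count:
  assumes l: "length bs \<le> l" "n \<le> l"
  shows "\<exists>b. runs count [A, W, (0, passed n 0), (0, passed 0 0), (0, word_cells bs)]
      (Suc (Suc l * Suc (6 * l + 8)) + ((2 * l + 3) + (2 * l + 3)))
      [A, W, (0, passed n 0), (0, passed (min (bits_val bs) n) 0), b]"
proof -
  define k where "k = bits_val bs"
  define good where "good j b \<longleftrightarrow> length b = length bs \<and> bits_val b + j = k" for j b
  let ?X = "\<lambda>j b. [A, W, (int j, passed n 0), (int j, passed j 0), (0, word_cells b)]"
  have "\<exists>b'. good (Suc j) b' \<and> runs decrement (?X j b) (6 * l + 8) (?X (Suc j) b')" if "good j b" "j < k" for j b
  proof -
    have "0 < bits_val b" "length b \<le> l" using that l by (simp_all add: good_def)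
    from runs_decrement_pos[OF this, of A W "int j" "passed n 0" j] obtain b' where
      b': "length b' = length b" "bits_val b = Suc (bits_val b')"
        "runs decrement (?X j b) (4 * l + 8) (?X (Suc j) b')" by (auto simp: add.commute)
    from b'(3) have "runs decrement (?X j b) (6 * l + 8) (?X (Suc j) b')" by (rule runs_mono) simp
    then show ?thesis using b'(1,2) that by (auto simp: good_def)
  qed
  then obtain nx where nx: "\<And>j b. good j b \<Longrightarrow> j < k \<Longrightarrow>
      good (Suc j) (nx j b) \<and> runs decrement (?X j b) (6 * l + 8) (?X (Suc j) (nx j b))" by metis
  \<comment> \<open>A pass only guarantees that some word of the right value results. Iterating the
    choice \<open>nx\<close> fixes these words, since \<open>runs_While\<close> expects one
    configuration for every index.\<close>
  define bl where "bl = rec_nat bs nx"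
  have bl: "bl 0 = bs" "\<And>j. bl (Suc j) = nx j (bl j)" by (simp_all add: bl_def)
  have g: "good j (bl j)" if "j \<le> k" for j
    using that by (induction j) (simp_all add: bl nx good_def[of 0] k_def)
  have step: "runs decrement (?X j (bl j)) (6 * l + 8) (?X (Suc j) (bl (Suc j)))" if "j < k" for j
    using nx[OF g] that by (simp add: bl(2))
  define K where "K = min k n"
  have "\<exists>b. runs (While (\<lambda>ss. ss ! 2 \<noteq> 0) decrement) (?X 0 bs) (Suc (Suc l * Suc (6 * l + 8)))
      [A, W, (int n, passed n 0), (int K, passed K 0), b]"
  proof (cases "k < n")
    case False
    have "runs (While (\<lambda>ss. ss ! 2 \<noteq> 0) decrement) (?X 0 (bl 0)) (Suc (n * Suc (6 * l + 8))) (?X n (bl n))"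
      by (rule runs_While[where X = "\<lambda>j. ?X j (bl j)"]) (use False step in \<open>simp_all add: passed_def\<close>)
    moreover have "K = n" using False by (simp add: K_def)
    moreover have "Suc (n * Suc (6 * l + 8)) \<le> Suc (Suc l * Suc (6 * l + 8))"
      using l(2) by (intro Suc_leI le_imp_less_Suc mult_le_mono1) simp
    ultimately show ?thesis unfolding bl(1) using runs_mono by blast
  next
    case True
    let ?f = "[A, W, (int n, passed n 0), (int k, passed k 0), (0, word_cells (replicate (length (bl k)) True))]"
    \<comment> \<open>There are \<open>k + 1\<close> passes: the last one finds the counter at zero
      and moves the head of tape 2 to the end, without adding to tape 3.\<close>
    let ?Y = "\<lambda>j. if j \<le> k then ?X j (bl j) else ?f"
    have len: "length (bl k) \<le> l" and z: "bits_val (bl k) = 0" using g[of k] l by (simp_all add: good_def)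
    have last: "runs decrement (?X k (bl k)) (6 * l + 8) ?f"
      using True l(2) by (intro runs_decrement_zero[OF z len]) simp_all
    have "runs (While (\<lambda>ss. ss ! 2 \<noteq> 0) decrement) (?Y 0) (Suc (Suc k * Suc (6 * l + 8))) (?Y (Suc k))"
    proof (rule runs_While)
      fix j assume "j < Suc k"
      then consider "j < k" | "j = k" by linarith
      then show "runs decrement (?Y j) (6 * l + 8) (?Y (Suc j))"
      proof cases
        case 1
        then show ?thesis using step[OF 1] by simp
      next
        case 2
        then show ?thesis using last by simp
      qed
      show "scan (?Y j) ! 2 \<noteq> 0" using \<open>j < Suc k\<close> True by (simp add: passed_def)
    qed (simp add: passed_def)
    moreover have "Suc (Suc k * Suc (6 * l + 8)) \<le> Suc (Suc l * Suc (6 * l + 8))"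
      using l(2) True by (intro Suc_leI le_imp_less_Suc mult_le_mono1) simp
    ultimately have "runs (While (\<lambda>ss. ss ! 2 \<noteq> 0) decrement) (?Y 0) (Suc (Suc l * Suc (6 * l + 8))) (?Y (Suc k))"
      by (rule runs_mono)
    moreover have "?Y 0 = ?X 0 bs" "?Y (Suc k) = ?f" by (simp_all add: bl(1))
    ultimately have "runs (While (\<lambda>ss. ss ! 2 \<noteq> 0) decrement) (?X 0 bs) (Suc (Suc l * Suc (6 * l + 8))) ?f"
      by (simp only:)
    moreover have "K = k" using True by (simp add: K_def)
    ultimately show ?thesis by blast
  qed
  then obtain b where b: "runs (While (\<lambda>ss. ss ! 2 \<noteq> 0) decrement) (?X 0 bs) (Suc (Suc l * Suc (6 * l + 8)))
      [A, W, (int n, passed n 0), (int K, passed K 0), b]" by blast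
  have K: "K \<le> l" using l by (simp add: K_def)
  have 2: "runs (rewind 2) [A, W, (int n, passed n 0), (int K, passed K 0), b] (2 * l + 3)
      [A, W, (0, passed n 0), (int K, passed K 0), b]"
    using l by (intro runs_rewind5(2)[OF unary_passed]) simp_all
  have 3: "runs (rewind 3) [A, W, (0, passed n 0), (int K, passed K 0), b] (2 * l + 3)
      [A, W, (0, passed n 0), (0, passed K 0), b]"
    using K by (intro runs_rewind5(3)[OF unary_passed]) simp_all
  have "runs count (?X 0 bs) (Suc (Suc l * Suc (6 * l + 8)) + ((2 * l + 3) + (2 * l + 3)))
      [A, W, (0, passed n 0), (0, passed K 0), b]"
    unfolding count_def by (rule runs_Seq[OF b runs_Seq[OF 2 3]])
  then show ?thesis unfolding K_def k_def of_nat_0 by blast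
qed

definition row_time :: "'a::comm_semiring_1 \<Rightarrow> 'a" where
  "row_time l = foreach_time l (foreach_time l 37 + foreach_time l 2)"

definition matrix_time :: "'a::comm_semiring_1 \<Rightarrow> 'a" where
  "matrix_time l = formark_time l (formark_time l (16 * row_time l + 1 + foreach_time l 2) +
     formark_time l (foreach_time l 2))"

section \<open>The program on an encoded instance\<close>

locale input_word =
  fixes E P :: "nat \<Rightarrow> nat \<Rightarrow> bool" and n :: nat and bs :: "bool list"
begin

definition mat :: "bool list" where
  "mat = concat (map (\<lambda>u. concat (map (\<lambda>v. [E u v, P u v]) [0..<n])) [0..<n])"

definition inp :: "bool list" where
  "inp = replicate n True @ False # mat @ bs"

text \<open>The position of entry \<open>(u, v)\<close> on the input tape, after \<open>n\<close>
  ones and a separator. The boundary values matter too: \<open>cur u n\<close> is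
  \<open>cur (Suc u) 0\<close>, and \<open>cur n 0\<close> is where the binary number
  begins.\<close>

definition cur :: "nat \<Rightarrow> nat \<Rightarrow> nat" where
  "cur u v = Suc n + 2 * (u * n + v)"

lemma cur_Suc: "cur u (Suc v) = cur u v + 2"
  by (simp add: cur_def)

abbreviation "l \<equiv> length inp"

lemma length_row: "length (concat (map (\<lambda>v. [E u v, P u v]) [0..<n])) = n * 2"
  by (rule length_concat_map_upt) simp

lemma length_mat: "length mat = n * (n * 2)"
  unfolding mat_def by (rule length_concat_map_upt) (rule length_row)

lemma length_inp: "l = Suc n + n * (n * 2) + length bs"
  by (simp add: inp_def length_mat)

lemma n_le: "n \<le> l" and bs_le: "length bs \<le> l"
  by (simp_all add: length_inp)

lemma mat_nth:
  assumes "u < n" "v < n"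
  shows "mat ! (2 * (u * n + v)) = E u v" "mat ! Suc (2 * (u * n + v)) = P u v"
proof -
  let ?r = "\<lambda>u. concat (map (\<lambda>v. [E u v, P u v]) [0..<n])"
  have r: "?r u ! (v * 2 + d) = [E u v, P u v] ! d" if "d < 2" for d
    using assms(2) that by (intro nth_concat_map_upt) simp_all
  have m: "mat ! (u * (n * 2) + (v * 2 + d)) = ?r u ! (v * 2 + d)" if "d < 2" for d
    unfolding mat_def using assms that by (intro nth_concat_map_upt length_row) simp_all
  have e: "2 * (u * n + v) = u * (n * 2) + (v * 2 + 0)" "Suc (2 * (u * n + v)) = u * (n * 2) + (v * 2 + 1)"
    by (simp_all add: algebra_simps)
  show "mat ! (2 * (u * n + v)) = E u v"
    using m[of 0] r[of 0] unfolding e(1) by simp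
  show "mat ! Suc (2 * (u * n + v)) = P u v"
    using m[of 1] r[of 1] unfolding e(2) by simp
qed

lemma inp_nth:
  assumes "u < n" "v < n"
  shows "Suc (cur u v) < l" "inp ! cur u v = E u v" "inp ! Suc (cur u v) = P u v"
proof -
  have "Suc u * n \<le> n * n" using assms by (intro mult_le_mono1) simp
  then have less: "Suc (2 * (u * n + v)) < length mat" using assms by (simp add: length_mat)
  then show "Suc (cur u v) < l" by (simp add: cur_def inp_def)
  show "inp ! cur u v = E u v" "inp ! Suc (cur u v) = P u v"
    using less mat_nth[OF assms] by (simp_all add: cur_def inp_def nth_append)
qed

lemma inp_True: "j < n \<Longrightarrow> word_cells inp (int j) = 2"
  using word_cells_nth[of j inp] n_le by (simp add: inp_def nth_append)

lemma inp_False: "word_cells inp (int n) = 1"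
  using word_cells_nth[of n inp] by (simp add: inp_def nth_append)

lemma inp_bs: "j < length bs \<Longrightarrow> word_cells inp (int (cur n 0 + j)) = bit (bs ! j)"
  using word_cells_nth[of "cur n 0 + j" inp] by (simp add: inp_def cur_def nth_append length_mat algebra_simps)

lemma inp_end: "length bs \<le> j \<Longrightarrow> word_cells inp (int (cur n 0 + j)) = 0"
  by (simp add: word_cells_def length_inp cur_def algebra_simps)

abbreviation A :: "nat \<Rightarrow> tape" where
  "A p \<equiv> (int p, word_cells inp)"

lemma runs_right: "runs (mv 0 Right) [A p, W, V, J, B] 1 [A (Suc p), W, V, J, B]"
  using runs_mv5(1)[of Right "int p"] by (simp add: add.commute)

lemma runs_load:
  "runs load [A 0, W, (0, passed 0 0), J, B] (4 * l * l + 9 * l + 9) [A (cur 0 0), W, (0, passed n 0), J, B]"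
proof -
  let ?X = "\<lambda>j. [A j, W, (int j, passed j 0), J, B]"
  have "runs (While (\<lambda>ss. ss ! 0 = 2) (put 2 3 Right ;; mv 0 Right)) (?X 0) (Suc (n * Suc (1 + 1))) (?X n)"
  proof (rule runs_While)
    fix j assume "j < n"
    then show "scan (?X j) ! 0 = 2" by (simp add: inp_True)
    have "runs (put 2 3 Right) (?X j) 1 [A j, W, (int (Suc j), passed (Suc j) 0), J, B]"
      using runs_put5(2)[of 3 Right "A j" W "int j" "passed j 0"] by (simp add: passed_Suc add.commute)
    then show "runs (put 2 3 Right ;; mv 0 Right) (?X j) (1 + 1) (?X (Suc j))"
      by (rule runs_Seq[OF _ runs_right])
  qed (simp add: inp_False)
  moreover have "runs (mv 0 Right) (?X n) 1 [A (Suc n), W, (int n, passed n 0), J, B]"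
    by (rule runs_right)
  moreover have "runs (rewind 2) [A (Suc n), W, (int n, passed n 0), J, B] (2 * l + 3)
      [A (Suc n), W, (0, passed n 0), J, B]"
    using n_le by (intro runs_rewind5(2)[OF unary_passed]) simp_all
  ultimately have "runs load (?X 0) (Suc (n * Suc (1 + 1)) + (1 + (2 * l + 3))) [A (Suc n), W, (0, passed n 0), J, B]"
    unfolding load_def by (intro runs_Seq)
  then have "runs load (?X 0) (4 * l * l + 9 * l + 9) [A (Suc n), W, (0, passed n 0), J, B]"
    by (rule runs_mono) (use n_le in simp)
  then show ?thesis by (simp add: cur_def)
qed

lemma runs_skip_to_bits:
  "runs (skip_matrix Right) [A (cur 0 0), W, (0, passed n 0), J, B] (formark_time l (foreach_time l 2))
     [A (cur n 0), W, (0, passed n 0), J, B]"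
  using runs_skip_matrix(1)[OF n_le, of "int (cur 0 0)"] by (simp add: cur_def algebra_simps)

lemma runs_copy_bits:
  "runs copy_bits [A (cur n 0), W, V, J, (0, word_cells [])] (5 * l + 4) [A l, W, V, J, (0, word_cells bs)]"
proof -
  let ?X = "\<lambda>j. [A (cur n 0 + j), W, V, J, (int j, word_cells (take j bs))]"
  let ?L = "length bs"
  have "runs (While (\<lambda>ss. ss ! 0 \<noteq> 0) (copy 4 ;; mv 0 Right)) (?X 0) (Suc (?L * Suc (1 + 1))) (?X ?L)"
  proof (rule runs_While)
    fix j assume j: "j < ?L"
    then show "scan (?X j) ! 0 \<noteq> 0" using inp_bs[OF j] by simp
    have "(word_cells (take j bs))(int j := word_cells inp (int (cur n 0 + j))) = word_cells (take (Suc j) bs)"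
      unfolding inp_bs[OF j] using word_cells_snoc[of "take j bs" "bs ! j"] j
      by (simp add: take_Suc_conv_app_nth)
    then have "runs (copy 4) (?X j) 1 [A (cur n 0 + j), W, V, J, (int (Suc j), word_cells (take (Suc j) bs))]"
      using runs_copy5(2)[of "int (cur n 0 + j)" "word_cells inp" W V J "int j" "word_cells (take j bs)"]
      by (simp add: add.commute)
    from runs_Seq[OF this runs_right]
    show "runs (copy 4 ;; mv 0 Right) (?X j) (1 + 1) (?X (Suc j))" by simp
  qed (use inp_end[of ?L] in simp)
  moreover have "runs (rewind 4) (?X ?L) (2 * l + 3) [A (cur n 0 + ?L), W, V, J, (0, word_cells (take ?L bs))]"
    using bs_le by (intro runs_rewind5(4)[where N = ?L]) (simp_all add: unary_word_cells)
  ultimately have "runs copy_bits (?X 0) (Suc (?L * Suc (1 + 1)) + (2 * l + 3))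
      [A (cur n 0 + ?L), W, V, J, (0, word_cells (take ?L bs))]"
    unfolding copy_bits_def by (intro runs_Seq)
  then have "runs copy_bits (?X 0) (5 * l + 4) [A (cur n 0 + ?L), W, V, J, (0, word_cells (take ?L bs))]"
    by (rule runs_mono) (use bs_le in simp)
  moreover have "cur n 0 + ?L = l" by (simp add: length_inp cur_def algebra_simps)
  ultimately show ?thesis by simp
qed

lemma runs_to_matrix:
  "runs to_matrix [A l, W, V, J, B] (4 * l + 5) [A (cur 0 0), W, V, J, B]"
proof -
  have "runs (rewind 0) [A l, W, V, J, B] (2 * l + 3) [A 0, W, V, J, B]"
    using runs_rewind5(1)[OF unary_word_cells, of l inp l] by simp
  moreover have "runs (While (\<lambda>ss. ss ! 0 = 2) (mv 0 Right)) [A 0, W, V, J, B] (Suc (n * Suc 1)) [A n, W, V, J, B]"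
  proof (rule runs_While[where X = "\<lambda>j. [A j, W, V, J, B]"])
    show "runs (mv 0 Right) [A j, W, V, J, B] 1 [A (Suc j), W, V, J, B]" for j
      by (rule runs_right)
  qed (simp_all add: inp_True inp_False)
  moreover have "runs (mv 0 Right) [A n, W, V, J, B] 1 [A (Suc n), W, V, J, B]" by (rule runs_right)
  ultimately have "runs to_matrix [A l, W, V, J, B] (2 * l + 3 + (Suc (n * Suc 1) + 1)) [A (Suc n), W, V, J, B]"
    unfolding to_matrix_def by (intro runs_Seq)
  then have "runs to_matrix [A l, W, V, J, B] (4 * l + 5) [A (Suc n), W, V, J, B]"
    by (rule runs_mono) (use n_le in simp)
  then show ?thesis by (simp add: cur_def)
qed

lemma runs_header:
  assumes K: "K \<le> n"
  shows "runs header [A p, outT w, (0, passed n 0), (0, passed K 0), B]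
    (foreach_time l (foreach_time l 17) + 1)
    [A p, outT (w @ replicate (K * n * 16) True @ [False]), (0, passed n 0), (0, passed K 0), B]"
proof -
  let ?one = "seqs (map (\<lambda>_. out (\<lambda>_. True)) tags)"
  have one: "runs ?one [A p, outT w, V, J, B] 17 [A p, outT (w @ replicate 16 True), V, J, B]" for w V J
    using runs_seqs[of tags "\<lambda>_. out (\<lambda>_. True)" "int p" "word_cells inp" V J B 1 "\<lambda>_. [True]" w] runs_out[of "\<lambda>_. True" "A p"]
    by (simp add: length_tags map_replicate_const)
  have row: "runs (foreach 2 ?one) [A p, outT w, (0, passed n 0), J, B] (foreach_time l 17)
      [A p, outT (w @ replicate (n * 16) True), (0, passed n 0), J, B]" for w J
  proof -
    have "runs ?one [A p, outT (w @ replicate (v * 16) True), (int v, passed n 0), J, B] 17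
      [A p, outT (w @ replicate (Suc v * 16) True), (int v, passed n 0), J, B]" for v
    proof -
      have e: "(w @ replicate (v * 16) True) @ replicate 16 True = w @ replicate (Suc v * 16) True"
        by (simp add: replicate_add[symmetric] add.commute)
      show ?thesis using one[of "w @ replicate (v * 16) True"] unfolding e .
    qed
    from runs_foreach2[where A = "\<lambda>_. A p", OF unary_passed n_le this] show ?thesis by simp
  qed
  have "runs (foreach 2 ?one) [A p, outT (w @ replicate (j * (n * 16)) True), (0, passed n 0), (int j, passed K 0), B]
      (foreach_time l 17) [A p, outT (w @ replicate (Suc j * (n * 16)) True), (0, passed n 0), (int j, passed K 0), B]" for j
    using row[of "w @ replicate (j * (n * 16)) True"] by (simp add: replicate_add[symmetric] add.commute)
  from runs_foreach3[where A = "\<lambda>_. A p" and l = l and N = K, OF unary_passed _ this] K n_le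
  have 1: "runs (foreach 3 (foreach 2 ?one)) [A p, outT w, (0, passed n 0), (0, passed K 0), B] (foreach_time l (foreach_time l 17))
      [A p, outT (w @ replicate (K * (n * 16)) True), (0, passed n 0), (0, passed K 0), B]" by simp
  from runs_Seq[OF 1 runs_out[of "\<lambda>_. False"]] show ?thesis
    unfolding header_def by (simp add: mult.assoc)
qed

definition line :: "nat \<Rightarrow> nat \<Rightarrow> nat \<Rightarrow> tag \<Rightarrow> bool list" where
  "line K i u t = concat (map (\<lambda>j. concat (map (\<lambda>v. block t (cmp i j) (u = v) (E u v) (P u v)) [0..<n])) [0..<K])"

text \<open>The input row \<open>u\<close> is read anew for every column track \<open>j\<close>,
  since the relation of the original vertices is the same on all tracks; hence the walk back after
  each pass.\<close>

lemma runs_row: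
  assumes u: "u < n" and K: "K \<le> n"
  shows "runs (row t) [A (cur u 0), outT w, (0, marks n u), (0, marks K i), B]
    (foreach_time l (foreach_time l 37 + foreach_time l 2))
    [A (cur u 0), outT (w @ line K i u t), (0, marks n u), (0, marks K i), B]"
proof -
  let ?b = "\<lambda>j v. block t (cmp i j) (u = v) (E u v) (P u v)"
  let ?l = "\<lambda>j. concat (map (?b j) [0..<n])"
  have step: "runs (foreach 2 (entry t) ;; foreach 2 (skip2 Left))
      [A (cur u 0), outT w, (0, marks n u), (int j, marks K i), B] (foreach_time l 37 + foreach_time l 2)
      [A (cur u 0), outT (w @ ?l j), (0, marks n u), (int j, marks K i), B]" if j: "j < K" for j w
  proof -
    have "runs (entry t) [A (cur u v), outT (w @ concat (map (?b j) [0..<v])), (int v, marks n u), (int j, marks K i), B] 37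
        [A (cur u (Suc v)), outT (w @ concat (map (?b j) [0..<Suc v])), (int v, marks n u), (int j, marks K i), B]" if v: "v < n" for v
      using runs_entry[OF inp_nth(1)[OF u v], of t "w @ concat (map (?b j) [0..<v])" "int v" "marks n u" "int j" "marks K i" B]
      by (simp add: inp_nth(2,3)[OF u v] marks_nth v j cmp_eq_2 cur_Suc)
    from runs_foreach2[OF unary_marks n_le this]
    have 1: "runs (foreach 2 (entry t)) [A (cur u 0), outT w, (0, marks n u), (int j, marks K i), B] (foreach_time l 37)
        [A (cur u n), outT (w @ ?l j), (0, marks n u), (int j, marks K i), B]" by simp
    have "int (cur u n) - 2 * int n = int (cur u 0)" by (simp add: cur_def)
    with runs_skip_row(2)[OF unary_marks[of n u] n_le, where h = "int (cur u n)" and c = "word_cells inp"]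
    have 2: "runs (foreach 2 (skip2 Left)) [A (cur u n), W, (0, marks n u), J, B] (foreach_time l 2)
        [A (cur u 0), W, (0, marks n u), J, B]" for W J by simp
    show ?thesis by (rule runs_Seq[OF 1 2])
  qed
  have "runs (foreach 2 (entry t) ;; foreach 2 (skip2 Left))
      [A (cur u 0), outT (w @ concat (map ?l [0..<j])), (0, marks n u), (int j, marks K i), B] (foreach_time l 37 + foreach_time l 2)
      [A (cur u 0), outT (w @ concat (map ?l [0..<Suc j])), (0, marks n u), (int j, marks K i), B]" if j: "j < K" for j
    using step[OF j, of "w @ concat (map ?l [0..<j])"] by simp
  from runs_foreach3[where A = "\<lambda>_. A (cur u 0)" and l = l, OF unary_marks _ this] K n_le
  show ?thesis unfolding row_def line_def by simp
qed

lemma runs_matrix: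
  assumes K: "K \<le> n"
  shows "runs matrix [A (cur 0 0), outT w, (0, passed n 0), (0, passed K 0), B] (matrix_time l)
    [A (cur 0 0), outT (w @ concat (map (\<lambda>i. concat (map (\<lambda>u. concat (map (line K i u) tags)) [0..<n])) [0..<K])),
      (0, passed n 0), (0, passed K 0), B]"
proof -
  let ?r = "\<lambda>i u. concat (map (line K i u) tags)"
  let ?R = "\<lambda>i. concat (map (?r i) [0..<n])"
  have rows: "runs (seqs (map row tags) ;; foreach 2 (skip2 Right))
      [A (cur u 0), outT w, (0, marks n u), (0, marks K i), B] (16 * row_time l + 1 + foreach_time l 2)
      [A (cur (Suc u) 0), outT (w @ ?r i u), (0, marks n u), (0, marks K i), B]" if u: "u < n" for i u w
  proof -
    have 1: "runs (seqs (map row tags)) [A (cur u 0), outT w, (0, marks n u), (0, marks K i), B] (16 * row_time l + 1)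
        [A (cur u 0), outT (w @ ?r i u), (0, marks n u), (0, marks K i), B]"
      using runs_seqs[where xs = tags and f = row and g = "line K i u", OF runs_row[OF u K]] by (simp only: row_time_def length_tags)
    have "int (cur u 0) + 2 * int n = int (cur (Suc u) 0)" by (simp add: cur_def)
    with runs_skip_row(1)[OF unary_marks[of n u] n_le, where h = "int (cur u 0)" and c = "word_cells inp"]
    have 2: "runs (foreach 2 (skip2 Right)) [A (cur u 0), W, (0, marks n u), J, B] (foreach_time l 2)
        [A (cur (Suc u) 0), W, (0, marks n u), J, B]" for W J by simp
    show ?thesis by (rule runs_Seq[OF 1 2])
  qed
  have outer: "runs (formark 2 (seqs (map row tags) ;; foreach 2 (skip2 Right)) ;; skip_matrix Left)
      [A (cur 0 0), outT w, (0, passed n 0), (0, marks K i), B]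
      (formark_time l (16 * row_time l + 1 + foreach_time l 2) + formark_time l (foreach_time l 2))
      [A (cur 0 0), outT (w @ ?R i), (0, passed n 0), (0, marks K i), B]" for i w
  proof -
    have "runs (seqs (map row tags) ;; foreach 2 (skip2 Right))
      [A (cur u 0), outT (w @ concat (map (?r i) [0..<u])), (0, marks n u), (0, marks K i), B]
      (16 * row_time l + 1 + foreach_time l 2)
      [A (cur (Suc u) 0), outT (w @ concat (map (?r i) [0..<Suc u])), (0, marks n u), (0, marks K i), B]" if u: "u < n" for u
      using rows[OF u, of "w @ concat (map (?r i) [0..<u])" i] by simp
    from runs_formark2[OF n_le this]
    have 1: "runs (formark 2 (seqs (map row tags) ;; foreach 2 (skip2 Right)))
      [A (cur 0 0), outT w, (0, passed n 0), (0, marks K i), B] (formark_time l (16 * row_time l + 1 + foreach_time l 2))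
      [A (cur n 0), outT (w @ ?R i), (0, passed n 0), (0, marks K i), B]" by simp
    have "int (cur n 0) - 2 * int n * int n = int (cur 0 0)" by (simp add: cur_def)
    with runs_skip_matrix(2)[OF n_le, of "int (cur n 0)" "word_cells inp"]
    have 2: "runs (skip_matrix Left) [A (cur n 0), W, (0, passed n 0), J, B] (formark_time l (foreach_time l 2))
        [A (cur 0 0), W, (0, passed n 0), J, B]" for W J by simp
    show ?thesis by (rule runs_Seq[OF 1 2])
  qed
  have "runs (formark 2 (seqs (map row tags) ;; foreach 2 (skip2 Right)) ;; skip_matrix Left)
      [A (cur 0 0), outT (w @ concat (map ?R [0..<i])), (0, passed n 0), (0, marks K i), B]
      (formark_time l (16 * row_time l + 1 + foreach_time l 2) + formark_time l (foreach_time l 2))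
      [A (cur 0 0), outT (w @ concat (map ?R [0..<Suc i])), (0, passed n 0), (0, marks K i), B]" for i
    using outer[of "w @ concat (map ?R [0..<i])" i] by simp
  from runs_formark3[where A = "\<lambda>_. A (cur 0 0)" and l = l and N = K, OF _ this] K n_le
  show ?thesis unfolding matrix_def matrix_time_def by simp
qed

end

section \<open>Adding two in binary\<close>

fun incr :: "bool list \<Rightarrow> bool list" where
  "incr [] = [True]"
| "incr (False # bs) = True # bs"
| "incr (True # bs) = False # incr bs"

lemma nat_bits_Suc: "nat_bits (Suc k) = incr (nat_bits k)"
proof (induction k rule: less_induct)
  case (less k)
  show ?case
  proof (cases "k = 0 \<or> even k")
    case True
    then show ?thesis
      by (auto simp: nat_bits.simps[of k] nat_bits.simps[of "Suc k"] nat_bits.simps[of 0])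
  next
    case False
    then have "Suc k div 2 = Suc (k div 2)" "k div 2 < k" by (auto elim!: oddE)
    then show ?thesis
      using False less by (simp add: nat_bits.simps[of k] nat_bits.simps[of "Suc k"])
  qed
qed

text \<open>Adding two keeps the lowest bit and increments the rest.\<close>

lemma nat_bits_add_2: "0 < k \<Longrightarrow> nat_bits (k + 2) = hd (nat_bits k) # incr (tl (nat_bits k))"
  by (cases "odd k") (simp_all add: nat_bits_Suc nat_bits.simps[of k])

text \<open>Writing the remainder as \<open>tl ys\<close> treats both ends of the carry alike: a
  zero that is replaced, and the end of the word, where a digit is added.\<close>

lemma incr_split:
  obtains a ys where "bs = replicate a True @ ys" "ys = [] \<or> \<not> hd ys"
    "incr bs = replicate a False @ True # tl ys"
proof (induction bs arbitrary: thesis)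
  case Nil
  then show ?case by (metis append_Nil incr.simps(1) list.sel(2) replicate_0)
next
  case (Cons b bs)
  show ?case
  proof (cases b)
    case True
    obtain a ys where "bs = replicate a True @ ys" "ys = [] \<or> \<not> hd ys"
      "incr bs = replicate a False @ True # tl ys" using Cons.IH by blast
    then show ?thesis using True by (intro Cons.prems[of "Suc a" ys]) simp_all
  next
    case False
    then show ?thesis by (intro Cons.prems[of 0 "b # bs"]) simp_all
  qed
qed

definition total_time :: "'a::comm_semiring_1 \<Rightarrow> 'a" where
  "total_time l = (4 * l * l + 9 * l + 9) + (formark_time l (foreach_time l 2) + ((5 * l + 4) + ((4 * l + 5) +
     ((1 + (1 + l) * (6 * l + 9) + ((2 * l + 3) + (2 * l + 3))) + ((foreach_time l (foreach_time l 17) + 1) +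
     (matrix_time l + (formark_time l (foreach_time l 2) + (6 * l + 6))))))))"

lemma poly_total_time: "poly (total_time [:0, 1:]) l = total_time (l :: nat)"
  by (simp add: total_time_def matrix_time_def row_time_def foreach_time_def formark_time_def algebra_simps)

lemma runs_append:
  "runs (put 1 (bit b) Right) [A, outT w, V, J, B] 1 [A, outT (w @ [b]), V, J, B]"
  "c h = bit b \<Longrightarrow> runs (copy 1) [(h, c), outT w, V, J, B] 1 [(h, c), outT (w @ [b]), V, J, B]"
  using runs_put5(1)[of "bit b" Right A "int (length w)" "word_cells w" V J B]
    runs_copy5(1)[of h c "int (length w)" "word_cells w" V J B] word_cells_snoc[of w b]
  by (simp_all add: add.commute)

context input_word
begin

lemma runs_add_two:
  assumes "bs \<noteq> []"
  shows "\<exists>a. runs add_two [A (cur n 0), outT w, V, J, B] (6 * l + 6)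
    [a, outT (w @ hd bs # incr (tl bs)), V, J, B]"
proof -
  obtain b bs' where bs: "bs = b # bs'" using assms by (cases bs) auto
  obtain a ys where ys: "bs' = replicate a True @ ys" "ys = [] \<or> \<not> hd ys"
    "incr bs' = replicate a False @ True # tl ys" by (rule incr_split)
  let ?p = "\<lambda>j. cur n 0 + j"
  let ?m = "length (tl ys)"
  have bs_eq: "bs = b # replicate a True @ ys" using bs ys(1) by simp
  have "runs (copy 1) [A (?p 0), outT w, V, J, B] 1 [A (?p 0), outT (w @ [b]), V, J, B]"
    using inp_bs[of 0] bs by (intro runs_append(2)) simp
  moreover have "runs (mv 0 Right) [A (?p 0), outT (w @ [b]), V, J, B] 1 [A (?p 1), outT (w @ [b]), V, J, B]"
    using runs_right[of "?p 0"] by simp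
  moreover have "runs (While (\<lambda>ss. ss ! 0 = 2) (put 1 1 Right ;; mv 0 Right)) [A (?p 1), outT (w @ [b]), V, J, B]
      (Suc (a * Suc (1 + 1))) [A (?p (1 + a)), outT (w @ b # replicate a False), V, J, B]"
  proof -
    let ?X = "\<lambda>j. [A (?p (1 + j)), outT (w @ b # replicate j False), V, J, B]"
    have "runs (While (\<lambda>ss. ss ! 0 = 2) (put 1 1 Right ;; mv 0 Right)) (?X 0) (Suc (a * Suc (1 + 1))) (?X a)"
    proof (rule runs_While)
      fix j assume j: "j < a"
      then have "bs ! (1 + j) = True" "1 + j < length bs" by (simp_all add: bs_eq nth_append)
      then show "scan (?X j) ! 0 = 2" using inp_bs[of "1 + j"] by simp
      have e: "(w @ b # replicate j False) @ [False] = w @ b # replicate (Suc j) False"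
        by (simp add: replicate_append_same)
      have "runs (put 1 1 Right) (?X j) 1 [A (?p (1 + j)), outT (w @ b # replicate (Suc j) False), V, J, B]"
        using runs_append(1)[of False "A (?p (1 + j))" "w @ b # replicate j False" V J B] unfolding e by simp
      from runs_Seq[OF this runs_right]
      show "runs (put 1 1 Right ;; mv 0 Right) (?X j) (1 + 1) (?X (Suc j))" by simp
    next
      show "\<not> scan (?X a) ! 0 = 2"
      proof (cases ys)
        case Nil
        then show ?thesis using inp_end[of "1 + a"] by (simp add: bs_eq)
      next
        case (Cons y zs)
        then have "bs ! (1 + a) = False" "1 + a < length bs" using ys(2) by (simp_all add: bs_eq nth_append)
        then show ?thesis using inp_bs[of "1 + a"] by simp
      qed
    qed
    then show ?thesis by simp
  qed
  moreover have "runs (put 1 2 Right) [A (?p (1 + a)), outT (w @ b # replicate a False), V, J, B] 1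
      [A (?p (1 + a)), outT (w @ b # replicate a False @ [True]), V, J, B]"
    using runs_append(1)[of True "A (?p (1 + a))" "w @ b # replicate a False" V J B] by simp
  moreover have "runs (mv 0 Right) [A (?p (1 + a)), outT (w @ b # replicate a False @ [True]), V, J, B] 1
      [A (?p (2 + a)), outT (w @ b # replicate a False @ [True]), V, J, B]"
    using runs_right[of "?p (1 + a)"] by simp
  moreover have "runs (While (\<lambda>ss. ss ! 0 \<noteq> 0) (copy 1 ;; mv 0 Right))
      [A (?p (2 + a)), outT (w @ b # replicate a False @ [True]), V, J, B] (Suc (?m * Suc (1 + 1)))
      [A (?p (2 + a + ?m)), outT (w @ b # replicate a False @ True # tl ys), V, J, B]"
  proof -
    let ?w = "\<lambda>j. w @ b # replicate a False @ True # take j (tl ys)"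
    let ?X = "\<lambda>j. [A (?p (2 + a + j)), outT (?w j), V, J, B]"
    have "runs (While (\<lambda>ss. ss ! 0 \<noteq> 0) (copy 1 ;; mv 0 Right)) (?X 0) (Suc (?m * Suc (1 + 1))) (?X ?m)"
    proof (rule runs_While)
      fix j assume j: "j < ?m"
      then obtain y zs where "ys = y # zs" by (cases ys) auto
      then have "bs ! (2 + a + j) = tl ys ! j" "2 + a + j < length bs"
        using j by (simp_all add: bs_eq nth_append)
      then have c: "word_cells inp (int (?p (2 + a + j))) = bit (tl ys ! j)" using inp_bs[of "2 + a + j"] by simp
      then show "scan (?X j) ! 0 \<noteq> 0" by simp
      have e: "?w j @ [tl ys ! j] = ?w (Suc j)" using j by (simp add: take_Suc_conv_app_nth)
      have "runs (copy 1) (?X j) 1 [A (?p (2 + a + j)), outT (?w (Suc j)), V, J, B]"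
        using runs_append(2)[of "word_cells inp" "int (?p (2 + a + j))" "tl ys ! j" "?w j" V J B, OF c] unfolding e .
      from runs_Seq[OF this runs_right]
      show "runs (copy 1 ;; mv 0 Right) (?X j) (1 + 1) (?X (Suc j))" by simp
    next
      have "length bs \<le> 2 + a + ?m" by (simp add: bs_eq)
      then show "\<not> scan (?X ?m) ! 0 \<noteq> 0" using inp_end[of "2 + a + ?m"] by simp
    qed
    then show ?thesis by simp
  qed
  ultimately have "runs add_two [A (?p 0), outT w, V, J, B]
      (1 + (1 + (Suc (a * Suc (1 + 1)) + (1 + (1 + Suc (?m * Suc (1 + 1)))))))
      [A (?p (2 + a + ?m)), outT (w @ b # replicate a False @ True # tl ys), V, J, B]"
    unfolding add_two_def by (intro runs_Seq)
  then have "runs add_two [A (?p 0), outT w, V, J, B] (6 * l + 6)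
      [A (?p (2 + a + ?m)), outT (w @ b # replicate a False @ True # tl ys), V, J, B]"
    by (rule runs_mono) (use bs_le bs_eq in simp)
  moreover have "hd bs # incr (tl bs) = b # replicate a False @ True # tl ys" by (simp add: bs ys(3))
  ultimately show ?thesis by (intro exI[of _ "A (?p (2 + a + ?m))"]) (simp only: add_0_right)
qed

lemma runs_reducer:
  assumes "bs \<noteq> []" and K: "K = min (bits_val bs) n"
  shows "\<exists>ts. runs reducer ((0, word_cells inp) # replicate (5 - 1) (0, word_cells [])) (total_time l) ts \<and>
    snd (ts ! 1) = word_cells (replicate (K * n * 16) True @ [False] @
      concat (map (\<lambda>i. concat (map (\<lambda>u. concat (map (line K i u) tags)) [0..<n])) [0..<K]) @
      hd bs # incr (tl bs))"
proof -
  let ?h = "replicate (K * n * 16) True @ [False]"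
  let ?M = "concat (map (\<lambda>i. concat (map (\<lambda>u. concat (map (line K i u) tags)) [0..<n])) [0..<K])"
  have Kn: "K \<le> n" using K by simp
  obtain B where count: "runs count [A (cur 0 0), outT [], (0, passed n 0), (0, passed 0 0), (0, word_cells bs)]
      (Suc (Suc l * Suc (6 * l + 8)) + ((2 * l + 3) + (2 * l + 3)))
      [A (cur 0 0), outT [], (0, passed n 0), (0, passed K 0), B]"
    using runs_count[OF bs_le n_le, of "A (cur 0 0)" "outT []"] K by blast
  obtain a where add: "runs add_two [A (cur n 0), outT (?h @ ?M), (0, passed n 0), (0, passed K 0), B] (6 * l + 6)
      [a, outT ((?h @ ?M) @ hd bs # incr (tl bs)), (0, passed n 0), (0, passed K 0), B]"
    using runs_add_two[OF assms(1)] by blast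
  have header: "runs header [A (cur 0 0), outT [], (0, passed n 0), (0, passed K 0), B]
    (foreach_time l (foreach_time l 17) + 1) [A (cur 0 0), outT ?h, (0, passed n 0), (0, passed K 0), B]"
    using runs_header[OF Kn, of "cur 0 0" "[]" B] by simp
  have "runs reducer [A 0, outT [], (0, passed 0 0), (0, passed 0 0), (0, word_cells [])]
      ((4 * l * l + 9 * l + 9) + (formark_time l (foreach_time l 2) + ((5 * l + 4) + ((4 * l + 5) +
      ((Suc (Suc l * Suc (6 * l + 8)) + ((2 * l + 3) + (2 * l + 3))) + ((foreach_time l (foreach_time l 17) + 1) +
      (matrix_time l + (formark_time l (foreach_time l 2) + (6 * l + 6)))))))))
      [a, outT ((?h @ ?M) @ hd bs # incr (tl bs)), (0, passed n 0), (0, passed K 0), B]"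
    unfolding reducer_def
    by (rule runs_Seq[OF runs_load runs_Seq[OF runs_skip_to_bits runs_Seq[OF runs_copy_bits
        runs_Seq[OF runs_to_matrix runs_Seq[OF count runs_Seq[OF header runs_Seq[OF runs_matrix[OF Kn]
        runs_Seq[OF runs_skip_to_bits add]]]]]]]])
  moreover have "[A 0, outT [], (0, passed 0 0), (0, passed 0 0), (0, word_cells [])] =
      (0, word_cells inp) # replicate (5 - 1) (0, word_cells [])"
    by (simp add: passed_0 eval_nat_numeral)
  moreover have "(4 * l * l + 9 * l + 9) + (formark_time l (foreach_time l 2) + ((5 * l + 4) + ((4 * l + 5) +
      ((Suc (Suc l * Suc (6 * l + 8)) + ((2 * l + 3) + (2 * l + 3))) + ((foreach_time l (foreach_time l 17) + 1) +
      (matrix_time l + (formark_time l (foreach_time l 2) + (6 * l + 6)))))))) = total_time l"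
    by (simp add: total_time_def)
  ultimately have "runs reducer ((0, word_cells inp) # replicate (5 - 1) (0, word_cells [])) (total_time l)
      [a, outT ((?h @ ?M) @ hd bs # incr (tl bs)), (0, passed n 0), (0, passed K 0), B]"
    by (simp only:)
  moreover have "snd ([a, outT ((?h @ ?M) @ hd bs # incr (tl bs)), (0, passed n 0), (0, passed K 0), B] ! 1) =
      word_cells (replicate (K * n * 16) True @ [False] @ ?M @ hd bs # incr (tl bs))"
    by simp
  ultimately show ?thesis by blast
qed

end

section \<open>The output as the encoding of the new graph\<close>

lemma concat_map_upt_mult:
  "concat (map f [0..<a * b]) = concat (map (\<lambda>i. concat (map (\<lambda>j. f (i * b + j)) [0..<b])) [0..<a])"
proof (induction a)
  case (Suc a)
  have "[0..<Suc a * b] = [0..<a * b] @ map (\<lambda>j. a * b + j) [0..<b]"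
    using upt_add_eq_append[of 0 "a * b" b] map_add_upt[of "a * b" b] by (simp add: add.commute)
  then show ?case using Suc by (simp add: comp_def)
qed simp

lemma map_tags: "map (\<lambda>m. f (tags ! m)) [0..<16] = map f tags"
proof -
  have "map f tags = map f (map ((!) tags) [0..<length tags])" by (simp only: map_nth)
  then show ?thesis by (simp add: length_tags comp_def)
qed

context reduction
begin

interpretation input_word "\<lambda>u v. {u, v} \<in> edges G" "\<lambda>u v. {u, v} \<in> protected_edges G" n bs for bs .

text \<open>By the mixed radix numbering the range up to \<open>N\<close> unfolds into three nested
  ranges, for rows and for columns, and these are the loops of \<open>matrix\<close>. Symmetry of
  adjacency turns the unordered pairs of \<open>encode\<close> into the ordered tests of
  \<open>edge_bit\<close> and \<open>prot_bit\<close>.\<close>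

lemma encode_graph:
  "encode (graph, k + 2) = replicate (K * n * 16) True @ [False] @
     concat (map (\<lambda>i. concat (map (\<lambda>u. concat (map (line K i u) tags)) [0..<n])) [0..<K]) @
     nat_bits (k + 2)"
proof -
  let ?e = "\<lambda>x y. [{x, y} \<in> edges graph, {x, y} \<in> protected_edges graph]"
  let ?x = "\<lambda>i u m. (i * n + u) * 16 + m"
  have split: "concat (map f [0..<N]) =
      concat (map (\<lambda>i. concat (map (\<lambda>u. concat (map (\<lambda>m. f (?x i u m)) [0..<16])) [0..<n])) [0..<K])" for f :: "nat \<Rightarrow> bool list"
    unfolding N_def concat_map_upt_mult[of _ "K * n"] concat_map_upt_mult[of _ K] ..
  have coord: "tag_of (?x i u m) = tags ! m" "track (?x i u m) = i" "vertex (?x i u m) = u" "?x i u m < N"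
    if "i < K" "u < n" "m < 16" for i u m
  proof -
    have d: "?x i u m div 16 = i * n + u" "?x i u m mod 16 = m"
      using that(3) by (simp_all only: div_mult_self3 mod_mult_self3 div_less mod_less, simp_all?)
    show "tag_of (?x i u m) = tags ! m" "track (?x i u m) = i" "vertex (?x i u m) = u"
      using that(2) unfolding tag_of_def track_def vertex_def d by simp_all
    have "Suc i * n \<le> K * n" using that by (intro mult_le_mono1) simp
    then have "i * n + u < K * n" using that by simp
    then show "?x i u m < N" using that(3) by (simp add: N_def)
  qed
  have entry: "?e (?x i u m) (?x j v m') =
      [edge_bit (tags ! m) (tags ! m') (cmp i j) (u = v) ({u, v} \<in> edges G) ({u, v} \<in> protected_edges G),
       prot_bit (tags ! m) (tags ! m') (cmp i j) (u = v) ({u, v} \<in> edges G) ({u, v} \<in> protected_edges G)]"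
    if "i < K" "u < n" "m < 16" "j < K" "v < n" "m' < 16" for i u m j v m'
    unfolding in_edges in_protected uadj_def ladj_def edge_bit_def prot_bit_def
      coord(1-3)[OF that(1-3)] coord(1-3)[OF that(4-6)]
    using coord(4)[OF that(1-3)] coord(4)[OF that(4-6)] by (simp only: Diff_iff simp_thms)
  have row: "concat (map (?e (?x i u m)) [0..<N]) = line K i u (tags ! m)" if "i < K" "u < n" "m < 16" for i u m
  proof -
    have "concat (map (\<lambda>m'. ?e (?x i u m) (?x j v m')) [0..<16]) =
        block (tags ! m) (cmp i j) (u = v) ({u, v} \<in> edges G) ({u, v} \<in> protected_edges G)" if "j < K" "v < n" for j v
    proof -
      let ?b = "\<lambda>t'. [edge_bit (tags ! m) t' (cmp i j) (u = v) ({u, v} \<in> edges G) ({u, v} \<in> protected_edges G),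
         prot_bit (tags ! m) t' (cmp i j) (u = v) ({u, v} \<in> edges G) ({u, v} \<in> protected_edges G)]"
      have "map (\<lambda>m'. ?e (?x i u m) (?x j v m')) [0..<16] = map (\<lambda>m'. ?b (tags ! m')) [0..<16]"
        using entry[OF \<open>i < K\<close> \<open>u < n\<close> \<open>m < 16\<close> that] by (intro map_cong refl) (simp only: set_upt atLeastLessThan_iff)
      also have "\<dots> = map ?b tags" by (rule map_tags)
      finally show ?thesis unfolding block_def by (rule arg_cong)
    qed
    then show ?thesis
      unfolding split line_def by (intro arg_cong[of _ _ concat] map_cong refl) simp
  qed
  have "concat (map (\<lambda>x. concat (map (?e x) [0..<N])) [0..<N]) =
      concat (map (\<lambda>i. concat (map (\<lambda>u. concat (map (\<lambda>m. line K i u (tags ! m)) [0..<16])) [0..<n])) [0..<K])"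
    unfolding split[of "\<lambda>x. concat (map (?e x) [0..<N])"]
    by (intro arg_cong[of _ _ concat] map_cong refl) (rule row; simp)
  also have "\<dots> = concat (map (\<lambda>i. concat (map (\<lambda>u. concat (map (line K i u) tags)) [0..<n])) [0..<K])"
    unfolding map_tags ..
  finally show ?thesis
    by (simp add: encode_def Let_def verts_graph N_def)
qed

lemma reducer_computes:
  assumes "0 < k" "K = min k n"
  shows "computes_within (tm_of 5 4 reducer) (poly (total_time [:0, 1:]) (length (encode (G, k))))
    (encode (G, k)) (encode (graph, k + 2))"
proof -
  have bs: "nat_bits k \<noteq> []" using assms(1) by (simp add: nat_bits.simps[of k])
  have enc: "encode (G, k) = inp (nat_bits k)"
    by (simp add: encode_def Let_def V inp_def mat_def)
  have K': "K = min (bits_val (nat_bits k)) n" using assms(2) by (simp add: bits_val_nat_bits)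
  obtain ts where ts: "runs reducer ((0, word_cells (encode (G, k))) # replicate (5 - 1) (0, word_cells []))
      (total_time (length (encode (G, k)))) ts" "snd (ts ! 1) = word_cells (encode (graph, k + 2))"
    using runs_reducer[OF bs K'] unfolding enc encode_graph nat_bits_add_2[OF assms(1)] by blast
  then show ?thesis unfolding poly_total_time by (rule computes_within_tm_of)
qed

end

theorem theorem2p2:
  "\<exists>F. polytime_computable_on instances encode encode F \<and>
       (\<forall>G k. (G, k) \<in> instances \<longrightarrow>
          (\<exists>G' k'. F (G, k) = (G', k') \<and> (G', k') \<in> instances \<and>
             (lazy_cops_win G k \<longleftrightarrow> cops_win G' k')))"
proof -
  \<comment> \<open>\<open>card (verts G)\<close> recovers \<open>n\<close> from the graph. Adding
    two to \<open>k\<close> rather than to the minimum spares the machine a binary representation of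
    the number of tracks.\<close>
  define F where "F = (\<lambda>(G, k :: nat). (reduction.graph G (card (verts G)) (min k (card (verts G))), k + 2))"
  have red: "reduction G (card (verts G)) (min k (card (verts G)))" if I: "(G, k) \<in> instances" for G k
  proof -
    have "wf_pgraph G" "0 < k" using I by (simp_all add: instances_def)
    moreover obtain n where "verts G = {..<n}" using I unfolding instances_def by blast
    moreover from this have "0 < n" using wf_verts_nonempty[OF \<open>wf_pgraph G\<close>] by (cases n) simp_all
    ultimately show ?thesis by (simp add: reduction_def)
  qed
  have "polytime_computable_on instances encode encode F"
    unfolding polytime_computable_on_def
  proof (intro exI conjI ballI)
    show "wf_tm (tm_of 5 4 reducer)" by (rule wf_tm_of[OF wf_reducer]) simp_all
    fix x assume x: "x \<in> instances"
    obtain G k where Gk: "x = (G, k)" by (cases x)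
    have "0 < k" using x Gk by (simp add: instances_def)
    with reduction.reducer_computes[OF red[of G k]] x
    show "computes_within (tm_of 5 4 reducer) (poly (total_time [:0, 1:]) (length (encode x))) (encode x) (encode (F x))"
      unfolding Gk F_def by simp
  qed
  moreover have "\<exists>G' k'. F (G, k) = (G', k') \<and> (G', k') \<in> instances \<and> (lazy_cops_win G k \<longleftrightarrow> cops_win G' k')"
    if I: "(G, k) \<in> instances" for G k
  proof -
    interpret reduction G "card (verts G)" "min k (card (verts G))" using red[OF I] .
    have "(graph, k + 2) \<in> instances"
      using wf_graph verts_graph by (auto simp: instances_def)
    then show ?thesis
      using lazy_cops_win_iff_cops_win_graph[OF refl] by (simp add: F_def)
  qed
  ultimately show ?thesis by blast
qed

end
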